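(* Assume that the generalized $\beta$-conformal change $L\mapsto\overline L=f(e^{\sigma}L,\beta)$ is projective and that $L$ is Riemannian. Then the projective hv-curvature tensor (Douglas tensor) $\overline D^h_{ijk}$ of $(M,\overline L)$ vanishes.
   Context: $(M,L)$ is an $n$-dimensional smooth Finsler manifold with canonical spray $G^i$ (geodesics: $\frac{dy^i}{dt}+2G^i=wy^i$, $y^i=dx^i/dt$, for some function $w$); $\dot\partial_i=\partial/\partial y^i$. $L$ is Riemannian if $g_{ij}=\frac12\dot\partial_i\dot\partial_jL^2$ depends only on $x$. A generalized $\beta$-conformal change is $L\mapsto\overline{L}=f(\widetilde L,\beta)$ with $\widetilde L=e^{\sigma(x)}L$, $\sigma$ a smooth function on $M$, $\beta=b_i(x)y^i$ a 1-form, and $f$ smooth and positively homogeneous of degree one in $(\widetilde L,\beta)$; it is assumed that $(M,\overline L)$ is a Finsler space, and that $m_i:=b_i-(\beta/L^2)y_i\ne0$ (with $y_i=g_{ij}y^j$) at the points under consideration. The change is projective if $(M,L)$ and $(M,\overline L)$ have the same geodesics up to parametrization. The Douglas tensor of a Finsler space with spray $G^i$ is $D^h_{ijk}=\dot\partial_i\dot\partial_j\dot\partial_k\left(G^h-\frac{1}{n+1}\,y^h\,\dot\partial_mG^m\right)$; $\overline D^h_{ijk}$ is that of $(M,\overline L)$. *)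

theory Defs
  imports "HOL-Analysis.Analysis"
begin

section \<open>Smooth functions\<close>

text \<open>These notions are used for open sets only.\<close>

primrec Ck_on :: "nat \<Rightarrow> 'a::euclidean_space set \<Rightarrow> ('a \<Rightarrow> 'b::real_normed_vector) \<Rightarrow> bool" where
  "Ck_on 0 S f \<longleftrightarrow> continuous_on S f"
| "Ck_on (Suc k) S f \<longleftrightarrow>
     (\<forall>x\<in>S. f differentiable (at x)) \<and>
     (\<forall>v. Ck_on k S (\<lambda>x. frechet_derivative f (at x) v))"

definition smooth_on :: "'a::euclidean_space set \<Rightarrow> ('a \<Rightarrow> 'b::real_normed_vector) \<Rightarrow> bool" where
  "smooth_on S f \<longleftrightarrow> (\<forall>k. Ck_on k S f)"

section \<open>Smooth manifolds and their tangent vectors\<close>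

text \<open>A chart is an open set together with a coordinate map; only the values of the map on the
  open set matter. The type \<open>'m\<close> is the manifold, its dimension is \<open>CARD('n)\<close>. The atlas is not
  required to be maximal.\<close>

type_synonym ('m, 'n) chart = "'m set \<times> ('m \<Rightarrow> real ^ 'n)"

definition chart_image :: "('m, 'n) chart \<Rightarrow> (real ^ 'n) set" where
  "chart_image c = snd c ` fst c"

definition chart_inv :: "('m, 'n) chart \<Rightarrow> real ^ 'n \<Rightarrow> 'm" where
  "chart_inv c = inv_into (fst c) (snd c)"

definition transition :: "('m, 'n) chart \<Rightarrow> ('m, 'n) chart \<Rightarrow> real ^ 'n \<Rightarrow> real ^ 'n" where
  "transition c d x = snd d (chart_inv c x)"

definition smooth_atlas ::
  "('m::{t2_space, second_countable_topology}, 'n::finite) chart set \<Rightarrow> bool" where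
  "smooth_atlas A \<longleftrightarrow>
     (\<forall>c\<in>A. open (fst c) \<and> open (chart_image c) \<and>
        homeomorphism (fst c) (chart_image c) (snd c) (chart_inv c)) \<and>
     \<Union> (fst ` A) = UNIV \<and>
     (\<forall>c\<in>A. \<forall>d\<in>A. smooth_on (snd c ` (fst c \<inter> fst d)) (transition c d))"

definition smooth_function :: "('m, 'n::finite) chart set \<Rightarrow> ('m \<Rightarrow> real) \<Rightarrow> bool" where
  "smooth_function A s \<longleftrightarrow> (\<forall>c\<in>A. smooth_on (chart_image c) (\<lambda>x. s (chart_inv c x)))"

text \<open>A tangent vector at \<open>p\<close> is the family of its coordinate vectors in all charts around \<open>p\<close>,
  related by the Jacobians of the transition maps. It is set to 0 at the other index values, so that
  equal tangent vectors are equal functions.\<close>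

type_synonym ('m, 'n) tvec = "('m, 'n) chart \<Rightarrow> real ^ 'n"

definition tangent_space ::
  "('m, 'n::finite) chart set \<Rightarrow> 'm \<Rightarrow> ('m, 'n) tvec set" where
  "tangent_space A p =
     {v. (\<forall>c\<in>A. \<forall>d\<in>A. p \<in> fst c \<and> p \<in> fst d \<longrightarrow>
            v d = frechet_derivative (transition c d) (at (snd c p)) (v c)) \<and>
         (\<forall>c. \<not> (c \<in> A \<and> p \<in> fst c) \<longrightarrow> v c = 0)}"

text \<open>The tangent vector at \<open>p\<close> with coordinates \<open>y\<close> in the chart \<open>c\<close>.\<close>

definition tangent_vec ::
  "('m, 'n::finite) chart set \<Rightarrow> ('m, 'n) chart \<Rightarrow> 'm \<Rightarrow> real ^ 'n \<Rightarrow> ('m, 'n) tvec" where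
  "tangent_vec A c p y =
     (\<lambda>d. if d \<in> A \<and> p \<in> fst d
          then frechet_derivative (transition c d) (at (snd c p)) y else 0)"

text \<open>Functions on the tangent bundle, and their expression in the induced coordinates \<open>(x, y)\<close>.\<close>

type_synonym ('m, 'n) tfun = "'m \<Rightarrow> ('m, 'n) tvec \<Rightarrow> real"

definition local_rep ::
  "('m, 'n::finite) chart set \<Rightarrow> ('m, 'n) chart \<Rightarrow> ('m, 'n) tfun \<Rightarrow>
   real ^ 'n \<Rightarrow> real ^ 'n \<Rightarrow> real" where
  "local_rep A c F x y = F (chart_inv c x) (tangent_vec A c (chart_inv c x) y)"

section \<open>Local Finsler geometry\<close>

definition partial :: "'n::finite \<Rightarrow> (real ^ 'n \<Rightarrow> real) \<Rightarrow> real ^ 'n \<Rightarrow> real" where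
  "partial i h z = deriv (\<lambda>t. h (z + t *\<^sub>R axis i 1)) 0"

definition partial_x ::
  "'n::finite \<Rightarrow> (real ^ 'n \<Rightarrow> real ^ 'n \<Rightarrow> real) \<Rightarrow> real ^ 'n \<Rightarrow> real ^ 'n \<Rightarrow> real" where
  "partial_x i H x y = partial i (\<lambda>x'. H x' y) x"

definition partial_y ::
  "'n::finite \<Rightarrow> (real ^ 'n \<Rightarrow> real ^ 'n \<Rightarrow> real) \<Rightarrow> real ^ 'n \<Rightarrow> real ^ 'n \<Rightarrow> real" where
  "partial_y i H x y = partial i (\<lambda>y'. H x y') y"

definition fund_tensor ::
  "(real ^ 'n::finite \<Rightarrow> real ^ 'n \<Rightarrow> real) \<Rightarrow> real ^ 'n \<Rightarrow> real ^ 'n \<Rightarrow> real ^ 'n ^ 'n" where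
  "fund_tensor F x y =
     (\<chi> i j. 1 / 2 * partial_y i (partial_y j (\<lambda>x y. (F x y)\<^sup>2)) x y)"

text \<open>The coefficients of the canonical spray,
  \<open>G\<^sup>i = 1/4 g\<^sup>i\<^sup>j (y\<^sup>k \<partial>\<^sub>k \<partial>'\<^sub>j F\<^sup>2 - \<partial>\<^sub>j F\<^sup>2)\<close>, where \<open>\<partial>'\<close> is the derivative in the fibre. With this
  normalization the geodesics parametrized proportionally to arc length are the solutions of
  \<open>x'' + 2 G (x, x') = 0\<close>.\<close>

definition spray ::
  "(real ^ 'n::finite \<Rightarrow> real ^ 'n \<Rightarrow> real) \<Rightarrow> real ^ 'n \<Rightarrow> real ^ 'n \<Rightarrow> real ^ 'n" where
  "spray F x y = (1 / 4) *\<^sub>R (matrix_inv (fund_tensor F x y) *v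
     (\<chi> j. (\<Sum>k\<in>UNIV. y $ k * partial_x k (partial_y j (\<lambda>x y. (F x y)\<^sup>2)) x y)
            - partial_x j (\<lambda>x y. (F x y)\<^sup>2) x y))"

definition douglas ::
  "(real ^ 'n::finite \<Rightarrow> real ^ 'n \<Rightarrow> real) \<Rightarrow> 'n \<Rightarrow> 'n \<Rightarrow> 'n \<Rightarrow> 'n \<Rightarrow>
   real ^ 'n \<Rightarrow> real ^ 'n \<Rightarrow> real" where
  "douglas F h i j k =
     partial_y i (partial_y j (partial_y k
       (\<lambda>x y. spray F x y $ h
          - 1 / (real CARD('n) + 1) * (y $ h * (\<Sum>m\<in>UNIV. partial_y m (\<lambda>x y. spray F x y $ m) x y)))))"

section \<open>Finsler manifolds\<close>

text \<open>Finsler functions are considered on the slit tangent bundle; their values on the zero section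
  play no role.\<close>

definition finsler ::
  "('m::{t2_space, second_countable_topology}, 'n::finite) chart set \<Rightarrow> ('m, 'n) tfun \<Rightarrow> bool" where
  "finsler A L \<longleftrightarrow> (\<forall>c\<in>A.
     smooth_on (chart_image c \<times> (- {0})) (\<lambda>(x, y). local_rep A c L x y) \<and>
     (\<forall>x\<in>chart_image c. \<forall>y. y \<noteq> 0 \<longrightarrow>
        local_rep A c L x y > 0 \<and>
        (\<forall>r>0. local_rep A c L x (r *\<^sub>R y) = r * local_rep A c L x y) \<and>
        (\<forall>v. v \<noteq> 0 \<longrightarrow> v \<bullet> (fund_tensor (local_rep A c L) x y *v v) > 0)))"

definition riemannian :: "('m, 'n::finite) chart set \<Rightarrow> ('m, 'n) tfun \<Rightarrow> bool" where
  "riemannian A L \<longleftrightarrow> (\<forall>c\<in>A. \<forall>x\<in>chart_image c. \<forall>y y'. y \<noteq> 0 \<longrightarrow> y' \<noteq> 0 \<longrightarrow>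
     fund_tensor (local_rep A c L) x y = fund_tensor (local_rep A c L) x y')"

text \<open>Regular curves on an open interval \<open>J\<close> that satisfy \<open>dy/dt + 2 G = w y\<close>, \<open>y = dx/dt\<close>, in all
  charts, for some function \<open>w\<close>. This class is invariant under orientation-preserving
  reparametrization, i.e. it consists of the geodesics with arbitrary parameter.\<close>

definition geodesic ::
  "('m::topological_space, 'n::finite) chart set \<Rightarrow> ('m, 'n) tfun \<Rightarrow> real set \<Rightarrow> (real \<Rightarrow> 'm) \<Rightarrow> bool" where
  "geodesic A L J \<gamma> \<longleftrightarrow>
     open J \<and> is_interval J \<and> continuous_on J \<gamma> \<and>
     (\<exists>w. \<forall>c\<in>A. \<exists>y. \<forall>t\<in>J. \<gamma> t \<in> fst c \<longrightarrow>
        ((\<lambda>s. snd c (\<gamma> s)) has_vector_derivative y t) (at t) \<and> y t \<noteq> 0 \<and>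
        (\<exists>z. (y has_vector_derivative z) (at t) \<and>
             z + 2 *\<^sub>R spray (local_rep A c L) (snd c (\<gamma> t)) (y t) = w t *\<^sub>R y t))"

definition projective ::
  "('m::topological_space, 'n::finite) chart set \<Rightarrow> ('m, 'n) tfun \<Rightarrow> ('m, 'n) tfun \<Rightarrow> bool" where
  "projective A L L' \<longleftrightarrow> (\<forall>J \<gamma>. geodesic A L J \<gamma> \<longleftrightarrow> geodesic A L' J \<gamma>)"

section \<open>Generalized \<open>\<beta>\<close>-conformal changes\<close>

definition form_coeff ::
  "('m, 'n::finite) chart set \<Rightarrow> ('m, 'n) chart \<Rightarrow> ('m, 'n) tfun \<Rightarrow> real ^ 'n \<Rightarrow> real ^ 'n" where
  "form_coeff A c \<beta> x = (\<chi> i. local_rep A c \<beta> x (axis i 1))"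

definition one_form :: "('m, 'n::finite) chart set \<Rightarrow> ('m, 'n) tfun \<Rightarrow> bool" where
  "one_form A \<beta> \<longleftrightarrow> (\<forall>c\<in>A. smooth_on (chart_image c) (form_coeff A c \<beta>) \<and>
     (\<forall>x\<in>chart_image c. \<forall>y.
        local_rep A c \<beta> x y = (\<Sum>i\<in>UNIV. form_coeff A c \<beta> x $ i * y $ i)))"

text \<open>The function \<open>f\<close> need not be smooth on the whole plane (as \<open>f (s, t) = sqrt (s\<^sup>2 + t\<^sup>2)\<close> shows),
  but on an open cone \<open>C\<close> containing all values of \<open>(e\<^sup>\<sigma> L, \<beta>)\<close> on the slit tangent bundle.\<close>

definition generalized_beta_conformal_change ::
  "('m, 'n::finite) chart set \<Rightarrow> ('m, 'n) tfun \<Rightarrow> ('m \<Rightarrow> real) \<Rightarrow> ('m, 'n) tfun \<Rightarrow>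
   (real \<times> real \<Rightarrow> real) \<Rightarrow> ('m, 'n) tfun \<Rightarrow> bool" where
  "generalized_beta_conformal_change A L \<sigma> \<beta> f L' \<longleftrightarrow>
     smooth_function A \<sigma> \<and> one_form A \<beta> \<and>
     (\<exists>C. open C \<and> smooth_on C f \<and>
        (\<forall>u\<in>C. \<forall>r>0. r *\<^sub>R u \<in> C \<and> f (r *\<^sub>R u) = r * f u) \<and>
        (\<forall>p. \<forall>v\<in>tangent_space A p. v \<noteq> (\<lambda>_. 0) \<longrightarrow>
           (exp (\<sigma> p) * L p v, \<beta> p v) \<in> C \<and>
           L' p v = f (exp (\<sigma> p) * L p v, \<beta> p v)))"

text \<open>The covector \<open>m\<^sub>i = b\<^sub>i - (\<beta> / L\<^sup>2) y\<^sub>i\<close> with \<open>y\<^sub>i = g\<^sub>i\<^sub>j y\<^sup>j\<close>.\<close>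

definition m_covector ::
  "('m, 'n::finite) chart set \<Rightarrow> ('m, 'n) chart \<Rightarrow> ('m, 'n) tfun \<Rightarrow> ('m, 'n) tfun \<Rightarrow>
   real ^ 'n \<Rightarrow> real ^ 'n \<Rightarrow> real ^ 'n" where
  "m_covector A c L \<beta> x y =
     form_coeff A c \<beta> x - (local_rep A c \<beta> x y / (local_rep A c L x y)\<^sup>2) *\<^sub>R
       (fund_tensor (local_rep A c L) x y *v y)"

end

theory Submission
  imports Defs
begin

text \<open>
  The Douglas tensor sees a spray only up to its projective class. If \<open>G'\<^sup>i = G\<^sup>i + P y\<^sup>i\<close> with a
  fibrewise differentiable \<open>P\<close> of degree one in \<open>y\<close>, then Euler's relation \<open>y\<^sup>m \<partial>P/\<partial>y\<^sup>m = P\<close> gives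
  \<open>\<partial>G'\<^sup>m/\<partial>y\<^sup>m = \<partial>G\<^sup>m/\<partial>y\<^sup>m + (n + 1) P\<close>, so \<open>G\<^sup>h - y\<^sup>h/(n + 1) \<partial>G\<^sup>m/\<partial>y\<^sup>m\<close> is the same for both
  sprays. For Riemannian \<open>L\<close> the functions \<open>G\<^sup>i\<close> are quadratic forms in \<open>y\<close>, hence so is this
  expression, and its third fibre derivatives vanish (\<open>douglas_eq_0\<close>, \<open>spray_quadratic\<close>).

  It remains to extract \<open>P\<close> from the hypothesis that the two metrics have the same geodesics
  (\<open>projective_imp_spray_parallel\<close>). If a geodesic of \<open>L\<close> with position \<open>x\<close> and velocity \<open>y\<close> at time 0
  is a geodesic of both metrics, subtracting the two equations shows that \<open>G' - G\<close> is a multiple of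
  \<open>y\<close> at \<open>(x, y)\<close>. So for every \<open>(x, y)\<close> with \<open>y \<noteq> 0\<close> such a geodesic has to be produced
  (\<open>geodesic_exists\<close>). In one chart it is a solution of \<open>x'' = - 2 G (x, x')\<close>, given by the
  Picard-Lindelof theorem because the spray is smooth on the slit tangent bundle. The geodesic
  equation must also hold in all other charts. This is the invariance of the Euler-Lagrange
  covector \<open>d/dt \<partial>E/\<partial>y\<^sup>i - \<partial>E/\<partial>x\<^sup>i\<close> of the energy \<open>E = L\<^sup>2\<close>: it transforms linearly under changes of
  coordinates (\<open>euler_lagrange_transform\<close>), and it vanishes exactly when \<open>x'' + 2 G = 0\<close>.
\<close>

section \<open>Calculus of smooth functions\<close>

abbreviation D :: "('a::euclidean_space \<Rightarrow> 'b::real_normed_vector) \<Rightarrow> 'a \<Rightarrow> 'a \<Rightarrow> 'b" where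
  "D f p \<equiv> frechet_derivative f (at p)"

lemma D_eqI: "(f has_derivative f') (at p) \<Longrightarrow> D f p v = f' v"
  using frechet_derivative_at by metis

lemma has_derivative_D: "f differentiable (at p) \<Longrightarrow> (f has_derivative D f p) (at p)"
  using frechet_derivative_works by blast

lemma D_cong:
  assumes "open S" "p \<in> S" "\<And>q. q \<in> S \<Longrightarrow> f q = g q"
  shows "D f p = D g p"
proof -
  have "(f has_derivative f') (at p) \<longleftrightarrow> (g has_derivative f') (at p)" for f'
    by (intro iffI; erule has_derivative_transform_within_open[OF _ assms(1,2)]) (simp_all add: assms(3))
  then show ?thesis
    by (simp add: frechet_derivative_def)
qed

lemma Ck_on_cong:
  assumes "open S" "\<And>x. x \<in> S \<Longrightarrow> f x = g x" "Ck_on k S f"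
  shows "Ck_on k S g"
  using assms(2,3)
proof (induction k arbitrary: f g)
  case 0
  then show ?case by (simp cong: continuous_on_cong)
next
  case (Suc k)
  have "g differentiable (at x)" if "x \<in> S" for x
  proof -
    have "f differentiable (at x)" using Suc.prems(2) that by simp
    from has_derivative_transform_within_open[OF has_derivative_D[OF this] assms(1) that] Suc.prems(1)
    show ?thesis unfolding differentiable_def by blast
  qed
  moreover have "Ck_on k S (\<lambda>x. D g x v)" for v
  proof (rule Suc.IH)
    show "D f x v = D g x v" if "x \<in> S" for x
      using D_cong[OF assms(1) that, of f g] Suc.prems(1) by simp
    show "Ck_on k S (\<lambda>x. D f x v)" using Suc.prems(2) by simp
  qed
  ultimately show ?case by simp
qed

lemma Ck_on_Suc_imp: "Ck_on (Suc k) S f \<Longrightarrow> Ck_on k S f"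
proof (induction k arbitrary: f)
  case 0
  then show ?case
    by (simp add: continuous_at_imp_continuous_on differentiable_imp_continuous_within)
next
  case (Suc k)
  from Suc.prems have "\<forall>v. Ck_on (Suc k) S (\<lambda>x. D f x v)" and d: "\<forall>x\<in>S. f differentiable (at x)"
    by simp_all
  then have "\<forall>v. Ck_on k S (\<lambda>x. D f x v)" using Suc.IH by blast
  with d show ?case by simp
qed

lemma Ck_on_const: "Ck_on k S (\<lambda>_. a)"
  by (induction k arbitrary: a) auto

lemma Ck_on_bounded_linear:
  assumes "bounded_linear T"
  shows "Ck_on k S T"
proof (cases k)
  case 0
  then show ?thesis using linear_continuous_on[OF assms] by simp
next
  case (Suc j)
  have d: "(T has_derivative T) (at x)" for x using assms by (rule bounded_linear_imp_has_derivative)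
  then have "D T x v = T v" for x v by (rule D_eqI)
  with d Suc show ?thesis by (auto simp: Ck_on_const differentiable_def)
qed

lemma Ck_on_add:
  assumes "open S" "Ck_on k S f" "Ck_on k S g"
  shows "Ck_on k S (\<lambda>x. f x + g x)"
  using assms(2,3)
proof (induction k arbitrary: f g)
  case 0
  then show ?case by (simp add: continuous_on_add)
next
  case (Suc k)
  then have df: "\<forall>x\<in>S. f differentiable (at x)" and dg: "\<forall>x\<in>S. g differentiable (at x)" by simp_all
  have c: "Ck_on k S (\<lambda>x. D f x v + D g x v)" for v
    using Suc by simp
  moreover have e: "D (\<lambda>x. f x + g x) x v = D f x v + D g x v" if "x \<in> S" for x v
    using df dg that by (intro D_eqI has_derivative_add has_derivative_D) auto
  ultimately have "Ck_on k S (\<lambda>x. D (\<lambda>x. f x + g x) x v)" for v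
    by - (rule Ck_on_cong[OF assms(1) e[symmetric] c])
  with df dg show ?case by simp
qed

lemma (in bounded_bilinear) Ck_on:
  assumes "open S" "Ck_on k S f" "Ck_on k S g"
  shows "Ck_on k S (\<lambda>x. prod (f x) (g x))"
  using assms(2,3)
proof (induction k arbitrary: f g)
  case 0
  then show ?case by (simp add: continuous_on)
next
  case (Suc k)
  then have df: "\<forall>x\<in>S. f differentiable (at x)" and dg: "\<forall>x\<in>S. g differentiable (at x)" by simp_all
  have "Ck_on k S f" "Ck_on k S g" using Suc.prems Ck_on_Suc_imp by blast+
  then have c: "Ck_on k S (\<lambda>x. prod (f x) (D g x v) + prod (D f x v) (g x))" for v
    using Suc by (intro Ck_on_add[OF assms(1)]) simp_all
  moreover have h: "((\<lambda>x. prod (f x) (g x)) has_derivative (\<lambda>v. prod (f x) (D g x v) + prod (D f x v) (g x))) (at x)"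
    if "x \<in> S" for x
    using df dg that by (intro FDERIV has_derivative_D) auto
  moreover have e: "D (\<lambda>x. prod (f x) (g x)) x v = prod (f x) (D g x v) + prod (D f x v) (g x)" if "x \<in> S" for x v
    by (rule D_eqI[OF h[OF that]])
  ultimately have "Ck_on k S (\<lambda>x. D (\<lambda>x. prod (f x) (g x)) x v)" for v
    by - (rule Ck_on_cong[OF assms(1) e[symmetric] c])
  moreover have "(\<lambda>x. prod (f x) (g x)) differentiable (at x)" if "x \<in> S" for x
    using h[OF that] by (auto simp: differentiable_def)
  ultimately show ?case by simp
qed

text \<open>The derivative of \<open>1/f\<close> is again a product of copies of \<open>1/f\<close> with a derivative of \<open>f\<close>, so each
  step of the induction uses the statement one order lower.\<close>

lemma Ck_on_inverse:
  fixes f :: "'a::euclidean_space \<Rightarrow> real"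
  assumes "open S" "\<And>x. x \<in> S \<Longrightarrow> f x \<noteq> 0" "Ck_on k S f"
  shows "Ck_on k S (\<lambda>x. inverse (f x))"
  using assms(3)
proof (induction k)
  case 0
  then show ?case using assms(2) by (simp add: continuous_on_inverse)
next
  case (Suc k)
  then have df: "\<forall>x\<in>S. f differentiable (at x)" by simp
  have i: "Ck_on k S (\<lambda>x. inverse (f x))" using Suc Ck_on_Suc_imp by blast
  have c: "Ck_on k S (\<lambda>x. (- 1) * ((inverse (f x) * D f x v) * inverse (f x)))" for v
    using Suc.prems by (intro bounded_bilinear.Ck_on[OF bounded_bilinear_mult assms(1)] i Ck_on_const) simp_all
  moreover have h: "((\<lambda>x. inverse (f x)) has_derivative (\<lambda>v. - (inverse (f x) * D f x v * inverse (f x)))) (at x)"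
    if "x \<in> S" for x
    using df assms(2) that by (intro Deriv.has_derivative_inverse has_derivative_D) auto
  moreover have e: "D (\<lambda>x. inverse (f x)) x v = (- 1) * ((inverse (f x) * D f x v) * inverse (f x))" if "x \<in> S" for x v
    using D_eqI[OF h[OF that]] by simp
  ultimately have "Ck_on k S (\<lambda>x. D (\<lambda>x. inverse (f x)) x v)" for v
    by - (rule Ck_on_cong[OF assms(1) e[symmetric] c])
  moreover have "(\<lambda>x. inverse (f x)) differentiable (at x)" if "x \<in> S" for x
    using h[OF that] by (auto simp: differentiable_def)
  ultimately show ?case by simp
qed

lemma smooth_on_differentiable: "smooth_on S f \<Longrightarrow> p \<in> S \<Longrightarrow> f differentiable (at p)"
  unfolding smooth_on_def using Ck_on.simps(2)[of 0 S f] by blast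

lemma smooth_on_has_derivative: "smooth_on S f \<Longrightarrow> p \<in> S \<Longrightarrow> (f has_derivative D f p) (at p)"
  using smooth_on_differentiable has_derivative_D by blast

lemma smooth_on_linear_D: "smooth_on S f \<Longrightarrow> p \<in> S \<Longrightarrow> linear (D f p)"
  using smooth_on_differentiable linear_frechet_derivative by blast

lemma smooth_on_continuous_on: "smooth_on S f \<Longrightarrow> continuous_on S f"
  unfolding smooth_on_def using Ck_on.simps(1)[of S f] by blast

lemma smooth_on_D: "smooth_on S f \<Longrightarrow> smooth_on S (\<lambda>p. D f p v)"
  unfolding smooth_on_def using Ck_on.simps(2)[of _ S f] by blast

lemma smooth_on_cong: "open S \<Longrightarrow> smooth_on S f \<Longrightarrow> (\<And>x. x \<in> S \<Longrightarrow> f x = g x) \<Longrightarrow> smooth_on S g"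
  unfolding smooth_on_def using Ck_on_cong by blast

lemma Ck_on_subset: "Ck_on k S f \<Longrightarrow> T \<subseteq> S \<Longrightarrow> Ck_on k T f"
  by (induction k arbitrary: f) (auto intro: continuous_on_subset)

lemma smooth_on_subset: "smooth_on S f \<Longrightarrow> T \<subseteq> S \<Longrightarrow> smooth_on T f"
  unfolding smooth_on_def using Ck_on_subset by blast

lemma smooth_on_const: "smooth_on S (\<lambda>_. a)"
  by (simp add: smooth_on_def Ck_on_const)

lemma smooth_on_bounded_linear: "bounded_linear T \<Longrightarrow> smooth_on S T"
  by (simp add: smooth_on_def Ck_on_bounded_linear)

lemma smooth_on_add: "open S \<Longrightarrow> smooth_on S f \<Longrightarrow> smooth_on S g \<Longrightarrow> smooth_on S (\<lambda>x. f x + g x)"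
  by (simp add: smooth_on_def Ck_on_add)

lemma smooth_on_scaleR:
  "open S \<Longrightarrow> smooth_on S f \<Longrightarrow> smooth_on S g \<Longrightarrow> smooth_on S (\<lambda>x. f x *\<^sub>R g x)"
  by (simp add: smooth_on_def bounded_bilinear.Ck_on[OF bounded_bilinear_scaleR])

lemma smooth_on_mult:
  fixes f g :: "'a::euclidean_space \<Rightarrow> real"
  shows "open S \<Longrightarrow> smooth_on S f \<Longrightarrow> smooth_on S g \<Longrightarrow> smooth_on S (\<lambda>x. f x * g x)"
  using smooth_on_scaleR[of S f g] by simp

lemma smooth_on_diff:
  fixes f g :: "'a::euclidean_space \<Rightarrow> 'b::real_normed_vector"
  assumes "open S" "smooth_on S f" "smooth_on S g"
  shows "smooth_on S (\<lambda>x. f x - g x)"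
  using smooth_on_add[OF assms(1,2) smooth_on_scaleR[OF assms(1) smooth_on_const[of S "- 1"] assms(3)]] by simp

lemma smooth_on_divide:
  fixes f g :: "'a::euclidean_space \<Rightarrow> real"
  assumes "open S" "smooth_on S f" "smooth_on S g" "\<And>x. x \<in> S \<Longrightarrow> g x \<noteq> 0"
  shows "smooth_on S (\<lambda>x. f x / g x)"
proof -
  have "smooth_on S (\<lambda>x. inverse (g x))"
    using assms by (auto simp: smooth_on_def intro!: Ck_on_inverse)
  from smooth_on_mult[OF assms(1,2) this] show ?thesis by (simp add: divide_inverse)
qed

lemma smooth_on_sum:
  assumes "open S" "\<And>i. i \<in> I \<Longrightarrow> smooth_on S (f i)"
  shows "smooth_on S (\<lambda>x. \<Sum>i\<in>I. f i x)"
  using assms(2)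
  by (induction I rule: infinite_finite_induct) (auto intro: smooth_on_const smooth_on_add assms(1))

lemma smooth_on_prod:
  fixes f :: "'i \<Rightarrow> 'a::euclidean_space \<Rightarrow> real"
  assumes "open S" "\<And>i. i \<in> I \<Longrightarrow> smooth_on S (f i)"
  shows "smooth_on S (\<lambda>x. \<Prod>i\<in>I. f i x)"
  using assms(2)
  by (induction I rule: infinite_finite_induct) (auto intro: smooth_on_const smooth_on_mult assms(1))

lemma smooth_on_det:
  fixes M :: "'a::euclidean_space \<Rightarrow> real ^ 'n ^ 'n::finite"
  assumes "open S" "\<And>i j. smooth_on S (\<lambda>x. M x $ i $ j)"
  shows "smooth_on S (\<lambda>x. det (M x))"
  unfolding det_def
  by (intro smooth_on_sum smooth_on_mult smooth_on_prod smooth_on_const assms)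

lemma D_inner:
  assumes "f differentiable (at p)"
  shows "D (\<lambda>q. f q \<bullet> b) p v = D f p v \<bullet> b"
  by (rule D_eqI) (intro has_derivative_inner_left has_derivative_D assms)

text \<open>The second difference of \<open>f\<close> over a small parallelogram with sides \<open>h v\<close> and \<open>h w\<close> is symmetric in
  the two directions. Applying the mean value theorem twice, in either order, writes it as \<open>h\<^sup>2\<close>
  times one of the two mixed derivatives at a nearby point. If these differed at \<open>p\<close>, they would
  still differ near \<open>p\<close> by continuity.\<close>

lemma symmetric_second_derivative_real:
  fixes f :: "'a::euclidean_space \<Rightarrow> real"
  assumes S: "open S" "p \<in> S" and f: "smooth_on S f"
  shows "D (\<lambda>q. D f q v) p w = D (\<lambda>q. D f q w) p v"
proof (rule ccontr)
  define F where "F v w q = D (\<lambda>q. D f q v) q w" for v w q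
  assume "D (\<lambda>q. D f q v) p w \<noteq> D (\<lambda>q. D f q w) p v"
  then have ne: "F v w p \<noteq> F w v p" by (simp add: F_def)
  define e where "e = \<bar>F v w p - F w v p\<bar> / 2"
  have "e > 0" using ne by (simp add: e_def)
  have cont: "continuous_on S (F v w)" for v w
    unfolding F_def by (intro smooth_on_continuous_on smooth_on_D f)
  have "\<exists>d>0. ball p d \<subseteq> S \<and> (\<forall>q\<in>ball p d. \<bar>F v w q - F v w p\<bar> < e)" for v w
  proof -
    have "continuous (at p) (F v w)" using cont S by (simp add: continuous_on_eq_continuous_at)
    then obtain d where d: "d > 0" "\<And>q. dist q p < d \<Longrightarrow> dist (F v w q) (F v w p) < e"
      using \<open>e > 0\<close> unfolding continuous_at_eps_delta by blast
    obtain d' where d': "d' > 0" "ball p d' \<subseteq> S" using S openE by blast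
    show ?thesis using d d' by (intro exI[of _ "min d d'"]) (auto simp: dist_commute dist_real_def)
  qed
  then obtain d1 d2 where d: "d1 > 0" "ball p d1 \<subseteq> S" "\<forall>q\<in>ball p d1. \<bar>F v w q - F v w p\<bar> < e"
      "d2 > 0" "ball p d2 \<subseteq> S" "\<forall>q\<in>ball p d2. \<bar>F w v q - F w v p\<bar> < e" by meson
  \<comment> \<open>the parallelogram with sides \<open>h v\<close>, \<open>h w\<close> at \<open>p\<close> lies in both balls\<close>
  define h where "h = min d1 d2 / (norm v + norm w + 1)"
  have h: "h > 0" using d by (simp add: h_def add_nonneg_pos)
  have hd: "h * (norm v + norm w) < min d1 d2"
  proof -
    have "0 < norm v + norm w + 1" using norm_ge_zero[of v] norm_ge_zero[of w] by linarith
    then have "h * (norm v + norm w + 1) = min d1 d2" by (simp add: h_def)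
    then show ?thesis using h unfolding distrib_left by linarith
  qed
  have near: "p + s *\<^sub>R v + t *\<^sub>R w \<in> ball p d1 \<inter> ball p d2" if "0 \<le> s" "s \<le> h" "0 \<le> t" "t \<le> h" for s t
  proof -
    have "norm (s *\<^sub>R v + t *\<^sub>R w) \<le> h * norm v + h * norm w"
      using that by (intro order_trans[OF norm_triangle_ineq] add_mono) (simp_all add: mult_right_mono)
    then have "norm (s *\<^sub>R v + t *\<^sub>R w) < min d1 d2" using hd by (simp add: distrib_left)
    moreover have "dist p (p + s *\<^sub>R v + t *\<^sub>R w) = norm (s *\<^sub>R v + t *\<^sub>R w)"
      by (metis add.assoc add_diff_cancel_left' dist_commute dist_norm)
    ultimately show ?thesis by simp
  qed
  define \<Delta> where "\<Delta> = f (p + h *\<^sub>R v + h *\<^sub>R w) - f (p + h *\<^sub>R v) - f (p + h *\<^sub>R w) + f p"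
  have line: "((\<lambda>s. g (q + s *\<^sub>R u)) has_real_derivative D g (q + s *\<^sub>R u) u) (at s)"
    if "g differentiable (at (q + s *\<^sub>R u))" for g :: "'a \<Rightarrow> real" and q u s
  proof -
    have "((\<lambda>s. q + s *\<^sub>R u) has_derivative (\<lambda>r. r *\<^sub>R u)) (at s)"
      by (auto intro!: derivative_eq_intros)
    from diff_chain_at[OF this has_derivative_D[OF that]]
    have "((\<lambda>s. g (q + s *\<^sub>R u)) has_derivative (\<lambda>r. D g (q + s *\<^sub>R u) (r *\<^sub>R u))) (at s)"
      by (simp add: o_def)
    then show ?thesis
      using linear_frechet_derivative[OF that]
      by (simp add: has_field_derivative_def linear_cmul mult.commute[of _ "D g (q + s *\<^sub>R u) u"])
  qed
  have mvt: "\<exists>s t. 0 \<le> s \<and> s \<le> h \<and> 0 \<le> t \<and> t \<le> h \<and> 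
      f (p + h *\<^sub>R v + h *\<^sub>R w) - f (p + h *\<^sub>R v) - f (p + h *\<^sub>R w) + f p = h * h * F v w (p + s *\<^sub>R v + t *\<^sub>R w)"
    if "\<And>s t. 0 \<le> s \<Longrightarrow> s \<le> h \<Longrightarrow> 0 \<le> t \<Longrightarrow> t \<le> h \<Longrightarrow> p + s *\<^sub>R v + t *\<^sub>R w \<in> S" for v w
  proof -
    have "\<exists>s>0. s < h \<and> (f (p + h *\<^sub>R w + h *\<^sub>R v) - f (p + h *\<^sub>R v)) - (f (p + h *\<^sub>R w + 0 *\<^sub>R v) - f (p + 0 *\<^sub>R v))
        = (h - 0) * (D f (p + h *\<^sub>R w + s *\<^sub>R v) v - D f (p + s *\<^sub>R v) v)"
    proof (rule MVT2[OF h])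
      fix s assume "0 \<le> s" "s \<le> h"
      then have "p + h *\<^sub>R w + s *\<^sub>R v \<in> S" "p + s *\<^sub>R v \<in> S"
        using that[of s h] that[of s 0] h by (auto simp: add_ac)
      then show "((\<lambda>s. f (p + h *\<^sub>R w + s *\<^sub>R v) - f (p + s *\<^sub>R v)) has_real_derivative
          D f (p + h *\<^sub>R w + s *\<^sub>R v) v - D f (p + s *\<^sub>R v) v) (at s)"
        by (intro DERIV_diff line smooth_on_differentiable[OF f])
    qed
    then obtain s where s: "0 < s" "s < h" and
      1: "f (p + h *\<^sub>R w + h *\<^sub>R v) - f (p + h *\<^sub>R v) - f (p + h *\<^sub>R w) + f p
        = h * (D f (p + h *\<^sub>R w + s *\<^sub>R v) v - D f (p + s *\<^sub>R v) v)" by auto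
    have "\<exists>t>0. t < h \<and> D f (p + s *\<^sub>R v + h *\<^sub>R w) v - D f (p + s *\<^sub>R v + 0 *\<^sub>R w) v
        = (h - 0) * F v w (p + s *\<^sub>R v + t *\<^sub>R w)"
    proof (rule MVT2[OF h])
      fix t assume "0 \<le> t" "t \<le> h"
      then have "p + s *\<^sub>R v + t *\<^sub>R w \<in> S" using that[of s t] s by simp
      then show "((\<lambda>t. D f (p + s *\<^sub>R v + t *\<^sub>R w) v) has_real_derivative F v w (p + s *\<^sub>R v + t *\<^sub>R w)) (at t)"
        unfolding F_def by (intro line smooth_on_differentiable[OF smooth_on_D[OF f]])
    qed
    then obtain t where t: "0 < t" "t < h" and
      2: "D f (p + s *\<^sub>R v + h *\<^sub>R w) v - D f (p + s *\<^sub>R v) v = h * F v w (p + s *\<^sub>R v + t *\<^sub>R w)" by auto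
    show ?thesis using s t 1 2 by (intro exI[of _ s] exI[of _ t]) (simp add: add_ac)
  qed
  have inS: "p + s *\<^sub>R v + t *\<^sub>R w \<in> S" if "0 \<le> s" "s \<le> h" "0 \<le> t" "t \<le> h" for s t
    using near[OF that] d by blast
  obtain s t where 1: "0 \<le> s" "s \<le> h" "0 \<le> t" "t \<le> h" "\<Delta> = h * h * F v w (p + s *\<^sub>R v + t *\<^sub>R w)"
    using mvt[of v w, OF inS] unfolding \<Delta>_def by auto
  have inS': "p + t *\<^sub>R w + s *\<^sub>R v \<in> S" if "0 \<le> t" "t \<le> h" "0 \<le> s" "s \<le> h" for s t
    using inS[OF that(3,4,1,2)] by (simp add: add_ac)
  obtain t' s' where 2: "0 \<le> t'" "t' \<le> h" "0 \<le> s'" "s' \<le> h" "\<Delta> = h * h * F w v (p + t' *\<^sub>R w + s' *\<^sub>R v)"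
    using mvt[of w v, OF inS'] unfolding \<Delta>_def by (auto simp: add_ac)
  have "F v w (p + s *\<^sub>R v + t *\<^sub>R w) = F w v (p + s' *\<^sub>R v + t' *\<^sub>R w)"
    using 1(5) 2(5) h by (simp add: add_ac)
  moreover have "\<bar>F v w (p + s *\<^sub>R v + t *\<^sub>R w) - F v w p\<bar> < e" using near[OF 1(1-4)] d by blast
  moreover have "\<bar>F w v (p + s' *\<^sub>R v + t' *\<^sub>R w) - F w v p\<bar> < e" using near[OF 2(3,4,1,2)] d by blast
  ultimately have "\<bar>F v w p - F w v p\<bar> < 2 * e" by linarith
  then show False by (simp add: e_def)
qed

lemma symmetric_second_derivative:
  fixes f :: "'a::euclidean_space \<Rightarrow> 'b::euclidean_space"
  assumes S: "open S" "p \<in> S" and f: "smooth_on S f"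
  shows "D (\<lambda>q. D f q v) p w = D (\<lambda>q. D f q w) p v"
proof (rule euclidean_eqI)
  fix b :: 'b
  have sm: "smooth_on S (\<lambda>q. f q \<bullet> b)"
    unfolding smooth_on_def
  proof
    fix k
    show "Ck_on k S (\<lambda>q. f q \<bullet> b)"
      using f by (intro bounded_bilinear.Ck_on[OF bounded_bilinear_inner S(1)] Ck_on_const) (simp add: smooth_on_def)
  qed
  have *: "D (\<lambda>q. D f q v) p w \<bullet> b = D (\<lambda>q. D (\<lambda>q. f q \<bullet> b) q v) p w" for v w
  proof -
    have "D (\<lambda>q. D f q v) p w \<bullet> b = D (\<lambda>q. D f q v \<bullet> b) p w"
      by (intro D_inner[symmetric] smooth_on_differentiable[OF smooth_on_D[OF f] S(2)])
    also have "\<dots> = D (\<lambda>q. D (\<lambda>q. f q \<bullet> b) q v) p w"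
      by (rule arg_cong[where f="\<lambda>g. g w"], rule D_cong[OF S])
         (simp add: D_inner smooth_on_differentiable[OF f])
    finally show ?thesis .
  qed
  show "D (\<lambda>q. D f q v) p w \<bullet> b = D (\<lambda>q. D f q w) p v \<bullet> b"
    unfolding * by (rule symmetric_second_derivative_real[OF S sm])
qed

lemma D_expand:
  fixes f :: "'a::euclidean_space \<Rightarrow> 'b::real_normed_vector"
  assumes "f differentiable (at p)"
  shows "D f p w = (\<Sum>b\<in>Basis. (w \<bullet> b) *\<^sub>R D f p b)"
proof -
  note l = linear_frechet_derivative[OF assms]
  have "D f p w = D f p (\<Sum>b\<in>Basis. (w \<bullet> b) *\<^sub>R b)" by (simp add: euclidean_representation)
  then show ?thesis by (simp add: linear_sum[OF l] linear_cmul[OF l])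
qed

lemma has_vector_derivative_compose_D:
  assumes "f differentiable (at (u t))" "(u has_vector_derivative u') (at t)"
  shows "((\<lambda>s. f (u s)) has_vector_derivative D f (u t) u') (at t)"
proof -
  note l = linear_frechet_derivative[OF assms(1)]
  from diff_chain_at[OF assms(2)[unfolded has_vector_derivative_def] has_derivative_D[OF assms(1)]]
  show ?thesis by (simp add: o_def has_vector_derivative_def linear_cmul[OF l])
qed

lemma has_vector_derivative_eventually_cong:
  assumes "(f has_vector_derivative f') (at t)" "\<forall>\<^sub>F s in nhds t. f s = g s"
  shows "(g has_vector_derivative f') (at t)"
proof -
  have "f t = g t" using eventually_nhds_x_imp_x[OF assms(2)] .
  moreover have "\<forall>\<^sub>F s in nhds t. s \<in> UNIV \<longrightarrow> f s = g s" using assms(2) by simp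
  ultimately show ?thesis using assms(1) by (simp add: has_vector_derivative_cong_ev[where f=f and g=g])
qed

text \<open>The product rule for \<open>Df(u(t)) w(t)\<close>. Since the derivative is available only as a family of
  directional derivatives, \<open>w(t)\<close> is expanded in the standard basis.\<close>

lemma has_vector_derivative_D_along:
  fixes f :: "'a::euclidean_space \<Rightarrow> 'b::real_normed_vector"
  assumes S: "open S" "u t \<in> S" and f: "smooth_on S f"
    and u: "(u has_vector_derivative u') (at t)" and w: "(w has_vector_derivative w') (at t)"
  shows "((\<lambda>s. D f (u s) (w s)) has_vector_derivative D f (u t) w' + D (\<lambda>q. D f q (w t)) (u t) u') (at t)"
proof -
  have diff: "f differentiable (at q)" if "q \<in> S" for q
    using smooth_on_differentiable[OF f that] .
  have diff2: "(\<lambda>q. D f q v) differentiable (at q)" if "q \<in> S" for q v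
    using smooth_on_differentiable[OF smooth_on_D[OF f] that] .
  have "((\<lambda>s. \<Sum>b\<in>Basis. (w s \<bullet> b) *\<^sub>R D f (u s) b) has_vector_derivative
      (\<Sum>b\<in>Basis. (w t \<bullet> b) *\<^sub>R D (\<lambda>q. D f q b) (u t) u' + (w' \<bullet> b) *\<^sub>R D f (u t) b)) (at t)"
  proof (intro has_vector_derivative_sum has_vector_derivative_scaleR)
    fix b :: 'a
    show "((\<lambda>s. w s \<bullet> b) has_real_derivative w' \<bullet> b) (at t)"
      using bounded_linear.has_vector_derivative[OF bounded_linear_inner_left w]
      by (simp add: has_real_derivative_iff_has_vector_derivative)
    show "((\<lambda>s. D f (u s) b) has_vector_derivative D (\<lambda>q. D f q b) (u t) u') (at t)"
      by (rule has_vector_derivative_compose_D[OF diff2[OF S(2)] u])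
  qed
  moreover have "(\<Sum>b\<in>Basis. (w t \<bullet> b) *\<^sub>R D (\<lambda>q. D f q b) (u t) u') = D (\<lambda>q. D f q (w t)) (u t) u'"
  proof (rule sym, rule D_eqI[THEN trans])
    show "((\<lambda>q. D f q (w t)) has_derivative (\<lambda>v. \<Sum>b\<in>Basis. (w t \<bullet> b) *\<^sub>R D (\<lambda>q. D f q b) (u t) v)) (at (u t))"
    proof (rule has_derivative_transform_within_open[OF _ S])
      show "((\<lambda>q. \<Sum>b\<in>Basis. (w t \<bullet> b) *\<^sub>R D f q b) has_derivative (\<lambda>v. \<Sum>b\<in>Basis. (w t \<bullet> b) *\<^sub>R D (\<lambda>q. D f q b) (u t) v)) (at (u t))"
        by (intro has_derivative_sum has_derivative_scaleR_right has_derivative_D diff2[OF S(2)])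
    qed (simp add: D_expand[OF diff, symmetric])
  qed simp
  ultimately have "((\<lambda>s. \<Sum>b\<in>Basis. (w s \<bullet> b) *\<^sub>R D f (u s) b) has_vector_derivative
      D f (u t) w' + D (\<lambda>q. D f q (w t)) (u t) u') (at t)"
    by (simp add: sum.distrib D_expand[OF diff[OF S(2)], symmetric] add.commute)
  moreover have "\<forall>\<^sub>F s in nhds t. (\<Sum>b\<in>Basis. (w s \<bullet> b) *\<^sub>R D f (u s) b) = D f (u s) (w s)"
  proof -
    have "(u \<longlongrightarrow> u t) (at t)" using u has_vector_derivative_continuous isContD by blast
    then have "\<forall>\<^sub>F s in nhds t. u s \<in> S"
      using S topological_tendstoD by (auto simp: eventually_nhds_conv_at)
    then show ?thesis by eventually_elim (simp add: D_expand[OF diff, symmetric])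
  qed
  ultimately show ?thesis
    by (rule has_vector_derivative_eventually_cong)
qed

section \<open>Local solutions of autonomous differential equations\<close>

lemma C1_lipschitz_on_cball:
  fixes X :: "'a::euclidean_space \<Rightarrow> 'b::euclidean_space"
  assumes "cball p r \<subseteq> S" and X: "Ck_on 1 S X"
  obtains K where "K \<ge> 0" "\<And>u v. u \<in> cball p r \<Longrightarrow> v \<in> cball p r \<Longrightarrow> norm (X u - X v) \<le> K * norm (u - v)"
proof -
  have X': "\<And>q. q \<in> S \<Longrightarrow> X differentiable (at q)" "\<And>v. continuous_on S (\<lambda>q. D X q v)"
    using X by simp_all
  define M where "M q = (\<Sum>b\<in>Basis. norm (D X q b))" for q
  have "continuous_on (cball p r) M"
    unfolding M_def using X'(2) assms(1)
    by (intro continuous_on_sum continuous_on_norm) (rule continuous_on_subset)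
  then have "bounded (M ` cball p r)"
    by (intro compact_imp_bounded compact_continuous_image) auto
  then obtain K where K: "K > 0" "\<And>q. q \<in> cball p r \<Longrightarrow> norm (M q) \<le> K"
    unfolding bounded_pos by auto
  have "norm (X u - X v) \<le> K * norm (u - v)" if "u \<in> cball p r" "v \<in> cball p r" for u v
  proof (rule differentiable_bound[OF convex_cball _ _ that])
    fix q assume q: "q \<in> cball p r"
    then have d: "X differentiable (at q)" using X'(1) assms(1) by blast
    show "(X has_derivative D X q) (at q within cball p r)"
      using has_derivative_D[OF d] has_derivative_at_withinI by blast
    have "norm (D X q v) \<le> norm (M q) * norm v" for v
    proof -
      have "norm (D X q v) \<le> (\<Sum>b\<in>Basis. norm ((v \<bullet> b) *\<^sub>R D X q b))"
        unfolding D_expand[OF d, of v] by (rule norm_sum)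
      also have "\<dots> \<le> (\<Sum>b\<in>Basis. norm v * norm (D X q b))"
        by (intro sum_mono) (simp add: Basis_le_norm mult_right_mono)
      also have "\<dots> = norm v * M q" by (simp add: M_def sum_distrib_left)
      finally show ?thesis by (simp add: M_def sum_nonneg mult.commute)
    qed
    then have "onorm (D X q) \<le> norm (M q)" by (intro onorm_bound) auto
    with K(2)[OF q] show "onorm (D X q) \<le> K" by linarith
  qed
  with K(1) show ?thesis by (intro that[of K]) auto
qed

text \<open>The Picard iteration on the Banach space of bounded continuous functions on the whole line. The
  integral is taken up to the clamped time \<open>cl t\<close>, so that no function on a subinterval is
  needed; inside the interval clamping has no effect. All integrals start at \<open>- \<delta>\<close>, and the value at
  time 0 is subtracted; this makes the solution two-sided without integrals of negative
  orientation, at the price of the factor 4 instead of 1.\<close>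

lemma lipschitz_ode_solution:
  fixes F :: "'a::euclidean_space \<Rightarrow> 'a"
  assumes K: "K \<ge> 0" "\<And>u v. norm (F u - F v) \<le> K * norm (u - v)" and M: "\<And>u. norm (F u) \<le> M"
    and \<delta>: "\<delta> > 0" "4 * \<delta> * K \<le> 1 / 2"
  obtains u where "u 0 = p" "\<And>t. norm (u t - p) \<le> 4 * \<delta> * M"
    "\<And>t. t \<in> {-\<delta><..<\<delta>} \<Longrightarrow> (u has_vector_derivative F (u t)) (at t)"
proof -
  have contF: "continuous_on UNIV F"
  proof (rule lipschitz_on_continuous_on[of K])
    show "K-lipschitz_on UNIV F" using K by (intro lipschitz_onI) (simp_all add: dist_norm)
  qed
  define cl where "cl t = max (-\<delta>) (min \<delta> t)" for t
  have cl: "cl t \<in> {-\<delta>..\<delta>}" for t using \<delta> by (auto simp: cl_def)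
  have cl_cont: "continuous_on UNIV cl" unfolding cl_def by (intro continuous_intros)
  define I where "I v t = integral {-\<delta>..cl t} (\<lambda>s. F (apply_bcontfun v s))" for v t
  have cont: "continuous_on T (\<lambda>s. F (apply_bcontfun v s))" for v T
    by (rule continuous_on_compose2[OF contF continuous_on_apply_bcontfun]) auto
  have integrable: "(\<lambda>s. F (apply_bcontfun v s)) integrable_on {a..b}" for v and a b :: real
    by (intro integrable_continuous_real cont)
  have contI: "continuous_on UNIV (I v)" for v
  proof -
    have "continuous_on {-\<delta>..\<delta>} (\<lambda>t. integral {-\<delta>..t} (\<lambda>s. F (apply_bcontfun v s)))"
      by (rule indefinite_integral_continuous_1[OF integrable])
    then show ?thesis
      unfolding I_def by (rule continuous_on_compose2[OF _ cl_cont]) (use cl in blast)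
  qed
  have M0: "M \<ge> 0" using M[of 0] norm_ge_zero order_trans by blast
  have I_le: "norm (I v t) \<le> 2 * \<delta> * M" for v t
  proof -
    have "norm (I v t) \<le> M * (cl t - (-\<delta>))"
      unfolding I_def using cl[of t] by (intro integral_bound cont M) auto
    also have "\<dots> \<le> M * (2 * \<delta>)" using cl[of t] M0 by (intro mult_left_mono) auto
    finally show ?thesis by (simp add: mult_ac)
  qed
  have I_lip: "norm (I v t - I w t) \<le> 2 * \<delta> * (K * dist v w)" for v w t
  proof -
    have "I v t - I w t = integral {-\<delta>..cl t} (\<lambda>s. F (apply_bcontfun v s) - F (apply_bcontfun w s))"
      unfolding I_def by (rule integral_diff[symmetric]) (rule integrable)+
    also have "norm \<dots> \<le> (K * dist v w) * (cl t - (-\<delta>))"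
    proof (rule integral_bound)
      fix s
      have "norm (F (apply_bcontfun v s) - F (apply_bcontfun w s)) \<le> K * dist (apply_bcontfun v s) (apply_bcontfun w s)"
        using K(2) by (simp add: dist_norm)
      also have "\<dots> \<le> K * dist v w" by (intro mult_left_mono dist_bounded K(1))
      finally show "norm (F (apply_bcontfun v s) - F (apply_bcontfun w s)) \<le> K * dist v w" .
    qed (use cl[of t] in \<open>auto intro!: continuous_on_diff cont\<close>)
    also have "\<dots> \<le> (K * dist v w) * (2 * \<delta>)" using cl[of t] K(1) by (intro mult_left_mono) auto
    finally show ?thesis by (simp add: mult_ac)
  qed
  have I_diff_le: "norm (I v t - I v s) \<le> 4 * \<delta> * M" for v s t
    using norm_triangle_ineq4[of "I v t" "I v s"] I_le[of v t] I_le[of v s] by linarith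
  define P where "P v = Bcontfun (\<lambda>t. p + (I v t - I v 0))" for v
  have P: "apply_bcontfun (P v) t = p + (I v t - I v 0)" for v t
  proof -
    have "(\<lambda>t. p + (I v t - I v 0)) \<in> bcontfun"
    proof (rule bcontfun_normI)
      show "continuous_on UNIV (\<lambda>t. p + (I v t - I v 0))" by (intro continuous_intros contI)
      show "norm (p + (I v t - I v 0)) \<le> norm p + 4 * \<delta> * M" for t
        using norm_triangle_ineq[of p "I v t - I v 0"] I_diff_le[of v t 0] by linarith
    qed
    then show ?thesis by (simp add: P_def Bcontfun_inverse)
  qed
  have "\<exists>!u. P u = u"
  proof (rule banach_fix_type[of "1/2"]; (intro allI)?)
    fix v w
    show "dist (P v) (P w) \<le> 1 / 2 * dist v w"
    proof (rule dist_bound)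
      fix t
      have "dist (apply_bcontfun (P v) t) (apply_bcontfun (P w) t) = norm ((I v t - I w t) - (I v 0 - I w 0))"
        by (simp add: P dist_norm algebra_simps)
      also have "\<dots> \<le> 2 * \<delta> * (K * dist v w) + 2 * \<delta> * (K * dist v w)"
        by (rule order_trans[OF norm_triangle_ineq4]) (intro add_mono I_lip)
      also have "\<dots> = (4 * \<delta> * K) * dist v w" by (simp add: algebra_simps)
      also have "\<dots> \<le> 1 / 2 * dist v w" using \<delta>(2) by (intro mult_right_mono) auto
      finally show "dist (apply_bcontfun (P v) t) (apply_bcontfun (P w) t) \<le> 1 / 2 * dist v w" .
    qed
  qed auto
  then obtain v where v: "P v = v" by blast
  let ?u = "apply_bcontfun v"
  have u: "?u t = p + (I v t - I v 0)" for t using P[of v t] v by simp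
  show ?thesis
  proof (rule that[of ?u])
    show "?u 0 = p" by (simp add: u)
    show "norm (?u t - p) \<le> 4 * \<delta> * M" for t using I_diff_le[of v t 0] by (simp add: u)
    fix t assume t: "t \<in> {-\<delta><..<\<delta>}"
    have "((\<lambda>t. integral {-\<delta>..t} (\<lambda>s. F (?u s))) has_vector_derivative F (?u t)) (at t within {-\<delta>..\<delta>})"
      using t by (intro integral_has_vector_derivative cont) auto
    moreover have "at t within {-\<delta>..\<delta>} = at t"
      using t by (intro at_within_interior) (simp add: interior_atLeastAtMost_real)
    ultimately have "((\<lambda>t. integral {-\<delta>..t} (\<lambda>s. F (?u s))) has_vector_derivative F (?u t)) (at t)" by simp
    then have "(I v has_vector_derivative F (?u t)) (at t)"
    proof (rule has_vector_derivative_eventually_cong)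
      show "\<forall>\<^sub>F s in nhds t. integral {-\<delta>..s} (\<lambda>s. F (?u s)) = I v s"
        by (rule eventually_nhds_in_open[THEN eventually_mono, of "{-\<delta><..<\<delta>}"])
           (use t in \<open>auto simp: I_def cl_def\<close>)
    qed
    then have "((\<lambda>s. p + (I v s - I v 0)) has_vector_derivative F (?u t)) (at t)"
      by (auto intro!: derivative_eq_intros)
    moreover have "?u = (\<lambda>s. p + (I v s - I v 0))" using u by auto
    ultimately show "(?u has_vector_derivative F (?u t)) (at t)" by simp
  qed
qed

text \<open>Composing the field with the nearest point map of a closed ball, which does not increase distances,
  turns the Lipschitz bound on the ball into a global one. For small \<open>\<delta>\<close> the solution
  of the modified equation does not leave the ball, where the two fields agree.\<close>

lemma C1_ode_local_solution:
  fixes X :: "'a::euclidean_space \<Rightarrow> 'a"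
  assumes "open S" "p \<in> S" and X: "Ck_on 1 S X"
  obtains \<delta> u where "\<delta> > 0" "u 0 = p" "\<And>t. t \<in> {-\<delta><..<\<delta>} \<Longrightarrow> u t \<in> S"
    "\<And>t. t \<in> {-\<delta><..<\<delta>} \<Longrightarrow> (u has_vector_derivative X (u t)) (at t)"
proof -
  obtain r where r: "r > 0" "cball p r \<subseteq> S" using assms(1,2) open_contains_cball_eq by blast
  obtain K where K: "K \<ge> 0" "\<And>u v. u \<in> cball p r \<Longrightarrow> v \<in> cball p r \<Longrightarrow> norm (X u - X v) \<le> K * norm (u - v)"
    using C1_lipschitz_on_cball[OF r(2) X] by blast
  define F where "F u = X (closest_point (cball p r) u)" for u
  have cp: "closest_point (cball p r) u \<in> cball p r" for u
    using r by (intro closest_point_in_set) auto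
  have lip: "norm (F u - F v) \<le> K * norm (u - v)" for u v
  proof -
    have "norm (F u - F v) \<le> K * norm (closest_point (cball p r) u - closest_point (cball p r) v)"
      unfolding F_def by (intro K cp)
    also have "\<dots> \<le> K * norm (u - v)"
      using closest_point_lipschitz[of "cball p r" u v] r K(1)
      by (intro mult_left_mono) (auto simp: dist_norm)
    finally show ?thesis .
  qed
  define M where "M = norm (X p) + K * r + 1"
  have bound: "norm (F u) \<le> M" for u
  proof -
    have "norm (F u - X p) \<le> K * norm (closest_point (cball p r) u - p)"
      unfolding F_def using r by (intro K cp) auto
    also have "\<dots> \<le> K * r" using cp[of u] K(1) by (intro mult_left_mono) (auto simp: dist_norm norm_minus_commute)
    finally show ?thesis using norm_triangle_ineq[of "F u - X p" "X p"] by (simp add: M_def)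
  qed
  have M: "M > 0" using K(1) r(1) by (simp add: M_def add_nonneg_pos)
  \<comment> \<open>the first bound makes the iteration a contraction, the second keeps the solution in the ball\<close>
  define \<delta> where "\<delta> = min (1 / (8 * (K + 1))) (r / (4 * M))"
  have \<delta>: "\<delta> > 0" using K(1) r(1) M by (simp add: \<delta>_def)
  have \<delta>K: "4 * \<delta> * K \<le> 1 / 2"
  proof -
    have "\<delta> * K \<le> 1 / (8 * (K + 1)) * (K + 1)" using K(1) \<delta> by (intro mult_mono) (auto simp: \<delta>_def)
    also have "\<dots> = 1 / 8" using K(1) by (simp add: field_simps)
    finally show ?thesis by simp
  qed
  have \<delta>M: "4 * \<delta> * M \<le> r"
  proof -
    have "\<delta> * M \<le> r / (4 * M) * M" using M by (intro mult_right_mono) (auto simp: \<delta>_def)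
    also have "\<dots> = r / 4" using M by simp
    finally show ?thesis by simp
  qed
  obtain u where u: "u 0 = p" "\<And>t. norm (u t - p) \<le> 4 * \<delta> * M"
    "\<And>t. t \<in> {-\<delta><..<\<delta>} \<Longrightarrow> (u has_vector_derivative F (u t)) (at t)"
    using lipschitz_ode_solution[OF K(1) lip bound \<delta> \<delta>K] by blast
  have in_ball: "u t \<in> cball p r" for t
    using u(2)[of t] \<delta>M by (simp add: dist_norm norm_minus_commute)
  then have "F (u t) = X (u t)" for t by (simp add: F_def closest_point_self)
  with u in_ball r(2) \<delta> show ?thesis by (intro that[of \<delta> u]) auto
qed

section \<open>The spray in a chart\<close>

lemma partial_eq_D:
  assumes "h differentiable (at z)"
  shows "partial i h z = D h z (axis i 1)"
proof -
  have "((\<lambda>t. z + t *\<^sub>R axis i 1) has_vector_derivative axis i 1) (at (0::real))"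
    by (auto intro!: derivative_eq_intros)
  from has_vector_derivative_compose_D[of h, OF _ this] assms
  have "((\<lambda>t. h (z + t *\<^sub>R axis i 1)) has_real_derivative D h z (axis i 1)) (at 0)"
    by (simp add: has_real_derivative_iff_has_vector_derivative)
  then show ?thesis unfolding partial_def by (rule DERIV_imp_deriv)
qed

lemma partial_cong:
  assumes "open S" "z \<in> S" "\<And>w. w \<in> S \<Longrightarrow> h w = h' w"
  shows "partial i h z = partial i h' z"
proof -
  have "((\<lambda>t. z + t *\<^sub>R axis i 1) \<longlongrightarrow> z + 0 *\<^sub>R axis i 1) (nhds (0::real))"
    by (intro tendsto_intros filterlim_ident)
  then have "\<forall>\<^sub>F t in nhds (0::real). z + t *\<^sub>R axis i 1 \<in> S"
    using assms(1,2) topological_tendstoD by fastforce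
  then have "\<forall>\<^sub>F t in nhds (0::real). h (z + t *\<^sub>R axis i 1) = h' (z + t *\<^sub>R axis i 1)"
    by eventually_elim (simp add: assms(3))
  then show ?thesis unfolding partial_def by (rule deriv_cong_ev) simp
qed

lemma partial_x_eq_D:
  assumes "open S" "(x, y) \<in> S" "h differentiable (at (x, y))" "\<And>x y. (x, y) \<in> S \<Longrightarrow> H x y = h (x, y)"
  shows "partial_x i H x y = D h (x, y) (axis i 1, 0)"
proof -
  have "(\<lambda>x. (x, y)) -` S = {x'. (x', y) \<in> S}" by auto
  then have o: "open {x'. (x', y) \<in> S}"
    using open_vimage[OF assms(1), of "\<lambda>x. (x, y)"] by (simp add: continuous_on_Pair continuous_on_id)
  have "((\<lambda>x. (x, y)) has_derivative (\<lambda>v. (v, 0))) (at x)"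
    by (auto intro!: derivative_eq_intros)
  from diff_chain_at[OF this has_derivative_D[OF assms(3)]]
  have d: "((\<lambda>x'. h (x', y)) has_derivative (\<lambda>v. D h (x, y) (v, 0))) (at x)" by (simp add: o_def)
  have "partial_x i H x y = partial i (\<lambda>x'. h (x', y)) x"
    unfolding partial_x_def by (rule partial_cong[OF o]) (use assms in auto)
  also have "\<dots> = D h (x, y) (axis i 1, 0)"
    using partial_eq_D[of "\<lambda>x'. h (x', y)" x i] d D_eqI[OF d] by (auto simp: differentiable_def)
  finally show ?thesis .
qed

lemma partial_y_eq_D:
  assumes "open S" "(x, y) \<in> S" "h differentiable (at (x, y))" "\<And>x y. (x, y) \<in> S \<Longrightarrow> H x y = h (x, y)"
  shows "partial_y i H x y = D h (x, y) (0, axis i 1)"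
proof -
  have "(\<lambda>y. (x, y)) -` S = {y'. (x, y') \<in> S}" by auto
  then have o: "open {y'. (x, y') \<in> S}"
    using open_vimage[OF assms(1), of "\<lambda>y. (x, y)"] by (simp add: continuous_on_Pair continuous_on_id)
  have "((\<lambda>y. (x, y)) has_derivative (\<lambda>v. (0, v))) (at y)"
    by (auto intro!: derivative_eq_intros)
  from diff_chain_at[OF this has_derivative_D[OF assms(3)]]
  have d: "((\<lambda>y'. h (x, y')) has_derivative (\<lambda>v. D h (x, y) (0, v))) (at y)" by (simp add: o_def)
  have "partial_y i H x y = partial i (\<lambda>y'. h (x, y')) y"
    unfolding partial_y_def by (rule partial_cong[OF o]) (use assms in auto)
  also have "\<dots> = D h (x, y) (0, axis i 1)"
    using partial_eq_D[of "\<lambda>y'. h (x, y')" y i] d D_eqI[OF d] by (auto simp: differentiable_def)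
  finally show ?thesis .
qed

lemma matrix_inv_mult_vec:
  fixes M :: "real ^ 'n ^ 'n::finite"
  assumes "invertible M"
  shows "M *v (matrix_inv M *v b) = b"
proof -
  have "M ** matrix_inv M = mat 1 \<and> matrix_inv M ** M = mat 1"
    using assms unfolding invertible_def matrix_inv_def by (rule someI_ex)
  then show ?thesis by (simp add: matrix_vector_mul_assoc)
qed

text \<open>Differentiating the homogeneity relation: a derivative in a fibre direction loses one degree, a
  derivative in a base direction keeps it.\<close>

lemma D_homogeneous:
  fixes h :: "('a::euclidean_space \<times> 'b::euclidean_space) \<Rightarrow> real"
  assumes "open S" and h: "smooth_on S h" and p: "(x, y) \<in> S" "(x, r *\<^sub>R y) \<in> S"
    and hom: "\<And>x y. (x, y) \<in> S \<Longrightarrow> h (x, r *\<^sub>R y) = c * h (x, y)"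
  shows "D h (x, r *\<^sub>R y) (v, r *\<^sub>R w) = c * D h (x, y) (v, w)"
proof -
  have "((\<lambda>p. (fst p, r *\<^sub>R snd p)) has_derivative (\<lambda>v. (fst v, r *\<^sub>R snd v))) (at (x, y))"
    by (auto intro!: derivative_eq_intros)
  moreover have "(h has_derivative D h (x, r *\<^sub>R y)) (at (fst (x, y), r *\<^sub>R snd (x, y)))"
    using smooth_on_has_derivative[OF h p(2)] by simp
  ultimately have 1: "((\<lambda>p. h (fst p, r *\<^sub>R snd p)) has_derivative (\<lambda>v. D h (x, r *\<^sub>R y) (fst v, r *\<^sub>R snd v))) (at (x, y))"
    using diff_chain_at by (fastforce simp: o_def)
  have "((\<lambda>p. c * h p) has_derivative (\<lambda>v. c * D h (x, y) v)) (at (x, y))"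
    by (intro has_derivative_mult_right smooth_on_has_derivative[OF h p(1)])
  then have "((\<lambda>p. h (fst p, r *\<^sub>R snd p)) has_derivative (\<lambda>v. c * D h (x, y) v)) (at (x, y))"
    by (rule has_derivative_transform_within_open[OF _ assms(1) p(1)]) (use hom in auto)
  from D_eqI[OF 1, of "(v, w)"] D_eqI[OF this, of "(v, w)"] show ?thesis by simp
qed

lemma euler_homogeneous:
  fixes h :: "'a::euclidean_space \<times> 'b::euclidean_space \<Rightarrow> real"
  assumes d: "h differentiable (at (x, y))" and hom: "\<And>r. r > 0 \<Longrightarrow> h (x, r *\<^sub>R y) = r ^ k * h (x, y)"
  shows "D h (x, y) (0, y) = of_nat k * h (x, y)"
proof -
  have "((\<lambda>r. r *\<^sub>R y) has_vector_derivative y) (at (1::real))"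
    by (auto intro!: derivative_eq_intros)
  then have "((\<lambda>r. (x, r *\<^sub>R y)) has_vector_derivative (0, y)) (at (1::real))"
    by (intro has_vector_derivative_Pair has_vector_derivative_const)
  then have "((\<lambda>r. h (x, r *\<^sub>R y)) has_vector_derivative D h (x, y) (0, y)) (at 1)"
    using has_vector_derivative_compose_D[of h "\<lambda>r. (x, r *\<^sub>R y)" 1 "(0, y)"] d by simp
  moreover have "((\<lambda>r. h (x, r *\<^sub>R y)) has_vector_derivative of_nat k * h (x, y)) (at 1)"
  proof (rule has_vector_derivative_eventually_cong)
    have "((\<lambda>r::real. r ^ k * h (x, y)) has_real_derivative of_nat k * h (x, y)) (at 1)"
      by (auto intro!: derivative_eq_intros)
    then show "((\<lambda>r::real. r ^ k * h (x, y)) has_vector_derivative of_nat k * h (x, y)) (at 1)"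
      by (simp add: has_real_derivative_iff_has_vector_derivative)
    show "\<forall>\<^sub>F r in nhds (1::real). r ^ k * h (x, y) = h (x, r *\<^sub>R y)"
      by (rule eventually_nhds_in_open[THEN eventually_mono, of "{0<..}"]) (use hom in auto)
  qed
  ultimately show ?thesis using vector_derivative_unique_at by blast
qed

definition energy :: "(real ^ 'n::finite \<Rightarrow> real ^ 'n \<Rightarrow> real) \<Rightarrow> (real ^ 'n) \<times> (real ^ 'n) \<Rightarrow> real" where
  "energy F p = (F (fst p) (snd p))\<^sup>2"

text \<open>The Euler-Lagrange expression \<open>d/dt \<partial>E/\<partial>y - \<partial>E/\<partial>x\<close> of the energy, evaluated on the test vector
  \<open>v\<close>, for a curve with position \<open>x\<close>, velocity \<open>y\<close> and acceleration \<open>a\<close>.\<close>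

definition euler_lagrange :: "(real ^ 'n::finite \<Rightarrow> real ^ 'n \<Rightarrow> real) \<Rightarrow> real ^ 'n \<Rightarrow> real ^ 'n \<Rightarrow> real ^ 'n \<Rightarrow> real ^ 'n \<Rightarrow> real" where
  "euler_lagrange F x y a v = D (\<lambda>q. D (energy F) q (0, v)) (x, y) (y, a) - D (energy F) (x, y) (v, 0)"

text \<open>A Finsler function in one chart, with \<open>U\<close> the image of the chart.\<close>

locale finsler_chart =
  fixes U :: "(real ^ 'n::finite) set" and F :: "real ^ 'n \<Rightarrow> real ^ 'n \<Rightarrow> real"
  assumes open_U: "open U"
    and smooth_F: "smooth_on (U \<times> (- {0})) (\<lambda>(x, y). F x y)"
    and hom_F: "\<And>x y r. x \<in> U \<Longrightarrow> y \<noteq> 0 \<Longrightarrow> r > 0 \<Longrightarrow> F x (r *\<^sub>R y) = r * F x y"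
    and fund_tensor_pos: "\<And>x y v. x \<in> U \<Longrightarrow> y \<noteq> 0 \<Longrightarrow> v \<noteq> 0 \<Longrightarrow> v \<bullet> (fund_tensor F x y *v v) > 0"
begin

abbreviation "\<Omega> \<equiv> U \<times> (- {0 :: real ^ 'n})"

abbreviation E :: "(real ^ 'n) \<times> (real ^ 'n) \<Rightarrow> real" where "E \<equiv> energy F"

abbreviation E' :: "'n \<Rightarrow> (real ^ 'n) \<times> (real ^ 'n) \<Rightarrow> real" where
  "E' j \<equiv> \<lambda>p. D E p (0, axis j 1)"

lemma open_\<Omega>: "open \<Omega>" by (intro open_Times open_U open_Compl) auto

lemma smooth_E: "smooth_on \<Omega> E"
proof -
  have "smooth_on \<Omega> (\<lambda>p. (case p of (x, y) \<Rightarrow> F x y) * (case p of (x, y) \<Rightarrow> F x y))"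
    by (intro smooth_on_mult open_\<Omega> smooth_F)
  then show ?thesis by (rule smooth_on_cong[OF open_\<Omega>]) (auto simp: energy_def power2_eq_square)
qed

lemma smooth_E': "smooth_on \<Omega> (E' j)" by (rule smooth_on_D[OF smooth_E])

lemma partial_y_E: "(x, y) \<in> \<Omega> \<Longrightarrow> partial_y j (\<lambda>x y. (F x y)\<^sup>2) x y = E' j (x, y)"
  by (rule partial_y_eq_D[OF open_\<Omega>]) (auto simp: energy_def intro: smooth_on_differentiable[OF smooth_E])

lemma fund_tensor_nth:
  "(x, y) \<in> \<Omega> \<Longrightarrow> fund_tensor F x y $ i $ j = 1 / 2 * D (E' j) (x, y) (0, axis i 1)"
  unfolding fund_tensor_def
  by (simp, rule partial_y_eq_D[OF open_\<Omega>])
     (auto simp: partial_y_E intro: smooth_on_differentiable[OF smooth_E'])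

lemma fund_tensor_sym: "(x, y) \<in> \<Omega> \<Longrightarrow> fund_tensor F x y $ i $ j = fund_tensor F x y $ j $ i"
  by (simp add: fund_tensor_nth symmetric_second_derivative[OF open_\<Omega> _ smooth_E])

lemma invertible_fund_tensor:
  assumes "(x, y) \<in> \<Omega>"
  shows "invertible (fund_tensor F x y)"
  unfolding invertible_left_inverse matrix_left_invertible_ker
proof (intro allI impI)
  fix v assume "fund_tensor F x y *v v = 0"
  then have "\<not> v \<bullet> (fund_tensor F x y *v v) > 0" by simp
  then show "v = 0" using assms fund_tensor_pos by auto
qed

lemma sum_D_axis_snd:
  fixes g :: "(real ^ 'n) \<times> (real ^ 'n) \<Rightarrow> real"
  assumes "smooth_on \<Omega> g" "p \<in> \<Omega>"
  shows "D g p (0, w) = (\<Sum>k\<in>UNIV. w $ k * D g p (0, axis k 1))"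
proof -
  note l = smooth_on_linear_D[OF assms]
  have "(0 :: real ^ 'n, w) = (\<Sum>k\<in>UNIV. w $ k *\<^sub>R (0, axis k 1))"
    by (subst (1) basis_expansion[of w, symmetric]) (simp add: sum_prod scalar_mult_eq_scaleR)
  then have "D g p (0, w) = D g p (\<Sum>k\<in>UNIV. w $ k *\<^sub>R (0, axis k 1))" by (rule arg_cong)
  also have "\<dots> = (\<Sum>k\<in>UNIV. D g p (w $ k *\<^sub>R (0, axis k 1)))" by (rule linear_sum[OF l])
  finally show ?thesis by (simp only: linear_cmul[OF l] real_scaleR_def)
qed

lemma sum_D_axis_fst:
  fixes g :: "(real ^ 'n) \<times> (real ^ 'n) \<Rightarrow> real"
  assumes "smooth_on \<Omega> g" "p \<in> \<Omega>"
  shows "D g p (w, 0) = (\<Sum>k\<in>UNIV. w $ k * D g p (axis k 1, 0))"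
proof -
  note l = smooth_on_linear_D[OF assms]
  have "(w, 0 :: real ^ 'n) = (\<Sum>k\<in>UNIV. w $ k *\<^sub>R (axis k 1, 0))"
    by (subst (1) basis_expansion[of w, symmetric]) (simp add: sum_prod scalar_mult_eq_scaleR)
  then have "D g p (w, 0) = D g p (\<Sum>k\<in>UNIV. w $ k *\<^sub>R (axis k 1, 0))" by (rule arg_cong)
  also have "\<dots> = (\<Sum>k\<in>UNIV. D g p (w $ k *\<^sub>R (axis k 1, 0)))" by (rule linear_sum[OF l])
  finally show ?thesis by (simp only: linear_cmul[OF l] real_scaleR_def)
qed

text \<open>The covector \<open>4 g\<^sub>i\<^sub>j G\<^sup>j\<close>, that is, the spray before the metric is inverted.\<close>

definition lowered_spray :: "(real ^ 'n) \<times> (real ^ 'n) \<Rightarrow> real ^ 'n" where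
  "lowered_spray p = (\<chi> j. D (E' j) p (snd p, 0) - D E p (axis j 1, 0))"

lemma spray_eq:
  assumes "(x, y) \<in> \<Omega>"
  shows "spray F x y = (1 / 4) *\<^sub>R (matrix_inv (fund_tensor F x y) *v lowered_spray (x, y))"
proof -
  have "partial_x k (partial_y j (\<lambda>x y. (F x y)\<^sup>2)) x y = D (E' j) (x, y) (axis k 1, 0)" for j k
    by (rule partial_x_eq_D[OF open_\<Omega> assms])
       (use assms in \<open>auto simp: partial_y_E intro: smooth_on_differentiable[OF smooth_E']\<close>)
  moreover have "partial_x j (\<lambda>x y. (F x y)\<^sup>2) x y = D E (x, y) (axis j 1, 0)" for j
    by (rule partial_x_eq_D[OF open_\<Omega> assms])
       (use assms in \<open>auto simp: energy_def intro: smooth_on_differentiable[OF smooth_E]\<close>)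
  moreover have "D (E' j) (x, y) (y, 0) = (\<Sum>k\<in>UNIV. y $ k * D (E' j) (x, y) (axis k 1, 0))" for j
    by (rule sum_D_axis_fst[OF smooth_E' assms])
  ultimately show ?thesis by (simp add: spray_def lowered_spray_def)
qed

lemma fund_tensor_spray:
  assumes "(x, y) \<in> \<Omega>"
  shows "fund_tensor F x y *v spray F x y = (1 / 4) *\<^sub>R lowered_spray (x, y)"
  unfolding spray_eq[OF assms]
  by (simp add: matrix_vector_mult_scaleR matrix_inv_mult_vec[OF invertible_fund_tensor[OF assms]])

lemma fund_tensor_cancel:
  assumes "(x, y) \<in> \<Omega>" "fund_tensor F x y *v v = fund_tensor F x y *v w"
  shows "v = w"
proof -
  have "inj ((*v) (fund_tensor F x y))"
    using invertible_fund_tensor[OF assms(1)] invertible_left_inverse matrix_left_invertible_injective by blast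
  then show ?thesis using assms(2) by (rule injD)
qed

lemma smooth_on_D_base:
  fixes g :: "(real ^ 'n) \<times> (real ^ 'n) \<Rightarrow> real"
  assumes "smooth_on \<Omega> g"
  shows "smooth_on \<Omega> (\<lambda>p. D g p (snd p, 0))"
proof (rule smooth_on_cong[OF open_\<Omega>])
  have "bounded_linear (\<lambda>p :: (real ^ 'n) \<times> (real ^ 'n). snd p $ k)" for k
    using bounded_linear_compose[OF bounded_linear_vec_nth bounded_linear_snd] .
  then show "smooth_on \<Omega> (\<lambda>p. \<Sum>k\<in>UNIV. snd p $ k * D g p (axis k 1, 0))"
    by (intro smooth_on_sum smooth_on_mult open_\<Omega> smooth_on_D assms smooth_on_bounded_linear)
qed (rule sum_D_axis_fst[OF assms, symmetric])

text \<open>By Cramer's rule the components of the spray are quotients of determinants with smooth entries.\<close>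

lemma smooth_spray: "smooth_on \<Omega> (\<lambda>p. spray F (fst p) (snd p) $ i)"
proof -
  let ?g = "\<lambda>p. fund_tensor F (fst p) (snd p)"
  have sg: "smooth_on \<Omega> (\<lambda>p. ?g p $ i $ j)" for i j
  proof (rule smooth_on_cong[OF open_\<Omega>])
    show "smooth_on \<Omega> (\<lambda>p. 1 / 2 * D (E' j) p (0, axis i 1))"
      by (intro smooth_on_mult open_\<Omega> smooth_on_const smooth_on_D[OF smooth_E'])
  qed (auto simp: fund_tensor_nth)
  have sr: "smooth_on \<Omega> (\<lambda>p. lowered_spray p $ j)" for j
    unfolding lowered_spray_def
    by (simp, intro smooth_on_diff open_\<Omega> smooth_on_D_base smooth_E' smooth_on_D[OF smooth_E])
  have det: "det (?g p) \<noteq> 0" if "p \<in> \<Omega>" for p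
    using invertible_fund_tensor[of "fst p" "snd p"] that by (simp add: invertible_det_nz)
  have "smooth_on \<Omega> (\<lambda>p. det (\<chi> i' j. if j = i then ((1 / 4) *\<^sub>R lowered_spray p) $ i' else ?g p $ i' $ j) / det (?g p))"
  proof (intro smooth_on_divide smooth_on_det open_\<Omega> sg det)
    fix i' j
    show "smooth_on \<Omega> (\<lambda>p. (\<chi> i' j. if j = i then ((1 / 4) *\<^sub>R lowered_spray p) $ i' else ?g p $ i' $ j) $ i' $ j)"
    proof (cases "j = i")
      case True
      moreover have "smooth_on \<Omega> (\<lambda>p. 1 / 4 * lowered_spray p $ i')"
        by (intro smooth_on_mult open_\<Omega> smooth_on_const sr)
      ultimately show ?thesis by simp
    next
      case False
      then show ?thesis by (simp add: sg)
    qed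
  qed
  then show ?thesis
  proof (rule smooth_on_cong[OF open_\<Omega>])
    fix p assume "p \<in> \<Omega>"
    then have "?g p *v spray F (fst p) (snd p) = (1 / 4) *\<^sub>R lowered_spray p"
      using fund_tensor_spray[of "fst p" "snd p"] by simp
    then have "spray F (fst p) (snd p) =
        (\<chi> k. det (\<chi> i j. if j = k then ((1 / 4) *\<^sub>R lowered_spray p) $ i else ?g p $ i $ j) / det (?g p))"
      using cramer[OF det[OF \<open>p \<in> \<Omega>\<close>]] by blast
    then show "det (\<chi> i' j. if j = i then ((1 / 4) *\<^sub>R lowered_spray p) $ i' else ?g p $ i' $ j) / det (?g p) = spray F (fst p) (snd p) $ i"
      by simp
  qed
qed

lemma E_hom: "(x, y) \<in> \<Omega> \<Longrightarrow> r > 0 \<Longrightarrow> E (x, r *\<^sub>R y) = r\<^sup>2 * E (x, y)"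
  by (simp add: energy_def hom_F power_mult_distrib)

lemma E'_hom:
  assumes "(x, y) \<in> \<Omega>" "r > 0"
  shows "E' j (x, r *\<^sub>R y) = r * E' j (x, y)"
proof -
  have p: "(x, r *\<^sub>R y) \<in> \<Omega>" using assms by simp
  have "D E (x, r *\<^sub>R y) (0, r *\<^sub>R axis j 1) = r\<^sup>2 * E' j (x, y)"
    by (rule D_homogeneous[OF open_\<Omega> smooth_E assms(1) p]) (use E_hom assms in auto)
  moreover have "D E (x, r *\<^sub>R y) (0, r *\<^sub>R axis j 1) = r * E' j (x, r *\<^sub>R y)"
    using linear_cmul[OF smooth_on_linear_D[OF smooth_E p], of r "(0, axis j 1)"] by simp
  ultimately show ?thesis using assms(2) by (simp add: power2_eq_square)
qed

lemma fund_tensor_hom: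
  assumes "(x, y) \<in> \<Omega>" "r > 0"
  shows "fund_tensor F x (r *\<^sub>R y) = fund_tensor F x y"
proof -
  have p: "(x, r *\<^sub>R y) \<in> \<Omega>" using assms by simp
  have "D (E' j) (x, r *\<^sub>R y) (0, axis i 1) = D (E' j) (x, y) (0, axis i 1)" for i j
  proof -
    have "D (E' j) (x, r *\<^sub>R y) (0, r *\<^sub>R axis i 1) = r * D (E' j) (x, y) (0, axis i 1)"
      by (rule D_homogeneous[OF open_\<Omega> smooth_E' assms(1) p]) (use E'_hom assms in auto)
    then show ?thesis
      using linear_cmul[OF smooth_on_linear_D[OF smooth_E'[of j] p], of r "(0, axis i 1)"] assms(2) by simp
  qed
  then show ?thesis by (simp add: vec_eq_iff fund_tensor_nth[OF p] fund_tensor_nth[OF assms(1)])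
qed

lemma spray_hom:
  assumes "(x, y) \<in> \<Omega>" "r > 0"
  shows "spray F x (r *\<^sub>R y) = r\<^sup>2 *\<^sub>R spray F x y"
proof -
  have p: "(x, r *\<^sub>R y) \<in> \<Omega>" using assms by simp
  have "D (E' j) (x, r *\<^sub>R y) (r *\<^sub>R y, 0) = r\<^sup>2 * D (E' j) (x, y) (y, 0)" for j
  proof -
    have "D (E' j) (x, r *\<^sub>R y) (y, r *\<^sub>R 0) = r * D (E' j) (x, y) (y, 0)"
      by (rule D_homogeneous[OF open_\<Omega> smooth_E' assms(1) p]) (use E'_hom assms in auto)
    then show ?thesis
      using linear_cmul[OF smooth_on_linear_D[OF smooth_E'[of j] p], of r "(y, 0)"] by (simp add: power2_eq_square)
  qed
  moreover have "D E (x, r *\<^sub>R y) (axis j 1, 0) = r\<^sup>2 * D E (x, y) (axis j 1, 0)" for j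
  proof -
    have "D E (x, r *\<^sub>R y) (axis j 1, r *\<^sub>R 0) = r\<^sup>2 * D E (x, y) (axis j 1, 0)"
      by (rule D_homogeneous[OF open_\<Omega> smooth_E assms(1) p]) (use E_hom assms in auto)
    then show ?thesis by simp
  qed
  ultimately have "lowered_spray (x, r *\<^sub>R y) = r\<^sup>2 *\<^sub>R lowered_spray (x, y)"
    by (simp add: lowered_spray_def vec_eq_iff right_diff_distrib)
  then show ?thesis
    by (simp add: spray_eq[OF p] spray_eq[OF assms(1)] fund_tensor_hom[OF assms] matrix_vector_mult_scaleR)
qed

text \<open>Split the derivative in the direction \<open>(y, a)\<close>. The \<open>a\<close> part is twice the fundamental tensor, since
  this is half the fibre Hessian of the energy, and the rest is the covector that defines the
  spray. Symmetry of the second derivatives makes the expression linear in \<open>v\<close>, so that it is enough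
  to compare coordinate vectors.\<close>

lemma euler_lagrange_eq:
  assumes p: "(x, y) \<in> \<Omega>"
  shows "euler_lagrange F x y a v = 2 * ((fund_tensor F x y *v (a + 2 *\<^sub>R spray F x y)) \<bullet> v)"
proof -
  let ?w = "fund_tensor F x y *v (a + 2 *\<^sub>R spray F x y)"
  have axis: "euler_lagrange F x y a (axis j 1) = 2 * ?w $ j" for j
  proof -
    note l = smooth_on_linear_D[OF smooth_E'[of j] p]
    have "D (E' j) (x, y) (y, a) = D (E' j) (x, y) (y, 0) + D (E' j) (x, y) (0, a)"
      using linear_add[OF l, of "(y, 0)" "(0, a)"] by simp
    moreover have "D (E' j) (x, y) (0, a) = 2 * (fund_tensor F x y *v a) $ j"
    proof -
      have "D (E' j) (x, y) (0, axis k 1) = 2 * fund_tensor F x y $ j $ k" for k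
        using fund_tensor_sym[OF p, of j k] fund_tensor_nth[OF p, of k j] by simp
      then show ?thesis
        by (simp add: sum_D_axis_snd[OF smooth_E' p, of j a] matrix_vector_mult_def sum_distrib_left mult_ac)
    qed
    moreover have "(fund_tensor F x y *v spray F x y) $ j = 1 / 4 * (D (E' j) (x, y) (y, 0) - D E (x, y) (axis j 1, 0))"
      by (simp add: fund_tensor_spray[OF p] lowered_spray_def)
    ultimately show ?thesis
      by (simp add: euler_lagrange_def matrix_vector_right_distrib matrix_vector_mult_scaleR)
  qed
  have sym: "D (\<lambda>q. D E q (0, v)) (x, y) (y, a) = D (\<lambda>q. D E q (y, a)) (x, y) (0, v)" for v
    by (rule symmetric_second_derivative[OF open_\<Omega> p smooth_E])
  have "euler_lagrange F x y a v = (\<Sum>k\<in>UNIV. v $ k * euler_lagrange F x y a (axis k 1))"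
    unfolding euler_lagrange_def sym
    by (simp add: sum_D_axis_snd[OF smooth_on_D[OF smooth_E] p, of _ v] sum_D_axis_fst[OF smooth_E p, of v]
        right_diff_distrib sum_subtractf)
  also have "\<dots> = 2 * (?w \<bullet> v)"
    by (simp add: axis inner_vec_def sum_distrib_left mult_ac)
  finally show ?thesis .
qed

lemma spray_eq_iff_euler_lagrange:
  assumes p: "(x, y) \<in> \<Omega>"
  shows "a + 2 *\<^sub>R spray F x y = 0 \<longleftrightarrow> (\<forall>v. euler_lagrange F x y a v = 0)"
proof
  assume "\<forall>v. euler_lagrange F x y a v = 0"
  then have "fund_tensor F x y *v (a + 2 *\<^sub>R spray F x y) = fund_tensor F x y *v 0"
    unfolding euler_lagrange_eq[OF p] by (metis inner_eq_zero_iff matrix_vector_mult_0_right mult_eq_0_iff zero_neq_numeral)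
  then show "a + 2 *\<^sub>R spray F x y = 0" by (rule fund_tensor_cancel[OF p])
qed (simp add: euler_lagrange_eq[OF p])

end

section \<open>The Euler-Lagrange covector under changes of coordinates\<close>

lemma tangent_map_curve:
  fixes \<phi> :: "'a::euclidean_space \<Rightarrow> 'b::euclidean_space"
  assumes "open W" "u t \<in> W" "smooth_on W \<phi>"
    and u: "(u has_vector_derivative u') (at t)" and w: "(w has_vector_derivative w') (at t)"
  shows "((\<lambda>s. (\<phi> (u s), D \<phi> (u s) (w s))) has_vector_derivative
    (D \<phi> (u t) u', D \<phi> (u t) w' + D (\<lambda>q. D \<phi> q (w t)) (u t) u')) (at t)"
  by (intro has_vector_derivative_Pair has_vector_derivative_D_along[OF assms]
      has_vector_derivative_compose_D[OF _ u] smooth_on_differentiable[OF assms(3,2)])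

lemma eventually_line_in_open:
  fixes x v :: "'a::real_normed_vector"
  assumes "open W" "x \<in> W"
  shows "\<forall>\<^sub>F s in nhds (0::real). x + s *\<^sub>R v \<in> W"
proof -
  have "((\<lambda>s. x + s *\<^sub>R v) \<longlongrightarrow> x + 0 *\<^sub>R v) (nhds (0::real))"
    by (intro tendsto_intros filterlim_ident)
  then show ?thesis using assms topological_tendstoD by fastforce
qed

lemma line_has_vector_derivative: "((\<lambda>s. x + s *\<^sub>R v) has_vector_derivative v) (at t)"
  by (auto intro!: derivative_eq_intros)

text \<open>Let \<open>\<Phi>(x, y) = (\<phi>(x), D\<phi>(x) y)\<close> be the tangent map, so that the energies are related by
  \<open>E = E' \<circ> \<Phi>\<close>. The second derivatives of \<open>\<phi>\<close> enter the Euler-Lagrange expression twice: through the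
  motion of the test vector \<open>D\<phi>(x) v\<close> along the curve, and through the base derivative of \<open>E\<close>
  in the direction \<open>v\<close>. The two contributions cancel because second derivatives are symmetric. On
  the right-hand side the acceleration is that of the image curve.\<close>

lemma euler_lagrange_transform:
  fixes U U' W :: "(real ^ 'n::finite) set"
  assumes F: "finsler_chart U F" and F': "finsler_chart U' F'"
    and W: "open W" "W \<subseteq> U" and \<phi>: "smooth_on W \<phi>" "\<phi> ` W \<subseteq> U'"
    and nz: "\<And>x y. x \<in> W \<Longrightarrow> y \<noteq> 0 \<Longrightarrow> D \<phi> x y \<noteq> 0"
    and FF': "\<And>x y. x \<in> W \<Longrightarrow> y \<noteq> 0 \<Longrightarrow> F x y = F' (\<phi> x) (D \<phi> x y)"
    and x: "x \<in> W" and y: "y \<noteq> 0"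
  shows "euler_lagrange F x y a v = euler_lagrange F' (\<phi> x) (D \<phi> x y) (D \<phi> x a + D (\<lambda>q. D \<phi> q y) x y) (D \<phi> x v)"
proof -
  let ?O = "W \<times> (- {0 :: real ^ 'n})" and ?O' = "U' \<times> (- {0 :: real ^ 'n})"
  define \<Phi> where "\<Phi> p = (\<phi> (fst p), D \<phi> (fst p) (snd p))" for p
  have oO: "open ?O" by (intro open_Times W open_Compl) auto
  have sE: "smooth_on ?O (energy F)"
    by (rule smooth_on_subset[OF finsler_chart.smooth_E[OF F]]) (use W in auto)
  have sE': "smooth_on ?O' (energy F')" by (rule finsler_chart.smooth_E[OF F'])
  have oO': "open ?O'" by (rule finsler_chart.open_\<Omega>[OF F'])
  have \<Phi>_in: "\<Phi> p \<in> ?O'" if "p \<in> ?O" for p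
    using that \<phi>(2) nz by (auto simp: \<Phi>_def)
  have lin: "linear (D \<phi> x)" if "x \<in> W" for x by (rule smooth_on_linear_D[OF \<phi>(1) that])
  have lin2: "linear (D (\<lambda>q. D \<phi> q w) x)" if "x \<in> W" for x w
    by (rule smooth_on_linear_D[OF smooth_on_D[OF \<phi>(1)] that])
  have EE': "energy F p = energy F' (\<Phi> p)" if "p \<in> ?O" for p
    using that by (cases p) (simp add: energy_def \<Phi>_def FF')
  have DE: "D (energy F) (x, y) (v, w) = D (energy F') (\<Phi> (x, y)) (D \<phi> x v, D \<phi> x w + D (\<lambda>q. D \<phi> q y) x v)"
    if p: "(x, y) \<in> ?O" for x y v w
  proof -
    let ?c = "\<lambda>s. (x, y) + s *\<^sub>R (v, w)"
    have c: "(?c has_vector_derivative (v, w)) (at 0)" by (rule line_has_vector_derivative)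
    have "((\<lambda>s. energy F (?c s)) has_vector_derivative D (energy F) (?c 0) (v, w)) (at 0)"
      by (rule has_vector_derivative_compose_D[OF _ c]) (use smooth_on_differentiable[OF sE p] in simp)
    moreover have "((\<lambda>s. energy F (?c s)) has_vector_derivative
        D (energy F') (\<Phi> (x, y)) (D \<phi> x v, D \<phi> x w + D (\<lambda>q. D \<phi> q y) x v)) (at 0)"
    proof (rule has_vector_derivative_eventually_cong)
      show "\<forall>\<^sub>F s in nhds 0. energy F' (\<Phi> (?c s)) = energy F (?c s)"
        using eventually_line_in_open[OF oO p, of "(v, w)"] by eventually_elim (rule EE'[symmetric])
      have "((\<lambda>s. (\<phi> (x + s *\<^sub>R v), D \<phi> (x + s *\<^sub>R v) (y + s *\<^sub>R w))) has_vector_derivative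
          (D \<phi> (x + 0 *\<^sub>R v) v, D \<phi> (x + 0 *\<^sub>R v) w + D (\<lambda>q. D \<phi> q (y + 0 *\<^sub>R w)) (x + 0 *\<^sub>R v) v)) (at 0)"
        by (rule tangent_map_curve[OF W(1) _ \<phi>(1)]) (use p in \<open>auto intro: line_has_vector_derivative\<close>)
      then have "((\<lambda>s. \<Phi> (?c s)) has_vector_derivative (D \<phi> x v, D \<phi> x w + D (\<lambda>q. D \<phi> q y) x v)) (at 0)"
        by (simp add: \<Phi>_def)
      from has_vector_derivative_compose_D[of "energy F'", OF _ this]
      show "((\<lambda>s. energy F' (\<Phi> (?c s))) has_vector_derivative
        D (energy F') (\<Phi> (x, y)) (D \<phi> x v, D \<phi> x w + D (\<lambda>q. D \<phi> q y) x v)) (at 0)"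
        using smooth_on_differentiable[OF sE' \<Phi>_in[OF p]] by simp
    qed
    ultimately show ?thesis using vector_derivative_unique_at by fastforce
  qed
  have DE0: "D (energy F) p (0, v) = D (energy F') (\<Phi> p) (0, D \<phi> (fst p) v)" if p: "p \<in> ?O" for p v
    using DE[of "fst p" "snd p" 0 v] p linear_0[OF lin] linear_0[OF lin2] by auto
  have p: "(x, y) \<in> ?O" using x y by simp
  \<comment> \<open>the time derivative of \<open>\<partial>E/\<partial>y\<close>, computed along a curve in the tangent bundle with velocity \<open>(y, a)\<close>\<close>
  let ?c = "\<lambda>s. (x, y) + s *\<^sub>R (y, a)"
  let ?D2 = "D (\<lambda>q. D \<phi> q y) x"
  let ?q' = "(D \<phi> x y, D \<phi> x a + ?D2 y)"
  have "((\<lambda>s. D (energy F) (?c s) (0, v)) has_vector_derivative D (\<lambda>q. D (energy F) q (0, v)) (?c 0) (y, a)) (at 0)"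
    by (rule has_vector_derivative_compose_D[OF _ line_has_vector_derivative])
       (use smooth_on_differentiable[OF smooth_on_D[OF sE] p] in simp)
  moreover have "((\<lambda>s. D (energy F) (?c s) (0, v)) has_vector_derivative
      D (energy F') (\<Phi> (x, y)) (0, D (\<lambda>q. D \<phi> q v) x y)
      + D (\<lambda>q. D (energy F') q (0, D \<phi> x v)) (\<Phi> (x, y)) ?q') (at 0)"
  proof (rule has_vector_derivative_eventually_cong)
    show "\<forall>\<^sub>F s in nhds 0. D (energy F') (\<Phi> (?c s)) (0, D \<phi> (x + s *\<^sub>R y) v) = D (energy F) (?c s) (0, v)"
      using eventually_line_in_open[OF oO p, of "(y, a)"] by eventually_elim (simp add: DE0)
    have "((\<lambda>s. (\<phi> (x + s *\<^sub>R y), D \<phi> (x + s *\<^sub>R y) (y + s *\<^sub>R a))) has_vector_derivative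
        (D \<phi> (x + 0 *\<^sub>R y) y, D \<phi> (x + 0 *\<^sub>R y) a + D (\<lambda>q. D \<phi> q (y + 0 *\<^sub>R a)) (x + 0 *\<^sub>R y) y)) (at 0)"
      by (rule tangent_map_curve[OF W(1) _ \<phi>(1)]) (use p in \<open>auto intro: line_has_vector_derivative\<close>)
    then have 1: "((\<lambda>s. \<Phi> (?c s)) has_vector_derivative ?q') (at 0)" by (simp add: \<Phi>_def)
    have "((\<lambda>s. D \<phi> (x + s *\<^sub>R y) v) has_vector_derivative D (\<lambda>q. D \<phi> q v) (x + 0 *\<^sub>R y) y) (at 0)"
      by (rule has_vector_derivative_compose_D[OF _ line_has_vector_derivative])
         (use smooth_on_differentiable[OF smooth_on_D[OF \<phi>(1)] x] in simp)
    then have 2: "((\<lambda>s. (0 :: real ^ 'n, D \<phi> (x + s *\<^sub>R y) v)) has_vector_derivative (0, D (\<lambda>q. D \<phi> q v) x y)) (at 0)"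
      by (intro has_vector_derivative_Pair has_vector_derivative_const) simp
    show "((\<lambda>s. D (energy F') (\<Phi> (?c s)) (0, D \<phi> (x + s *\<^sub>R y) v)) has_vector_derivative
      D (energy F') (\<Phi> (x, y)) (0, D (\<lambda>q. D \<phi> q v) x y)
      + D (\<lambda>q. D (energy F') q (0, D \<phi> x v)) (\<Phi> (x, y)) ?q') (at 0)"
      using has_vector_derivative_D_along[OF oO' _ sE' 1 2] \<Phi>_in[OF p] by simp
  qed
  ultimately have A: "D (\<lambda>q. D (energy F) q (0, v)) (x, y) (y, a) =
      D (energy F') (\<Phi> (x, y)) (0, ?D2 v) + D (\<lambda>q. D (energy F') q (0, D \<phi> x v)) (\<Phi> (x, y)) ?q'"
    using vector_derivative_unique_at symmetric_second_derivative[OF W(1) x \<phi>(1), of v y] by fastforce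
  have "D (energy F) (x, y) (v, 0) = D (energy F') (\<Phi> (x, y)) (D \<phi> x v, ?D2 v)"
    using DE[OF p, of v 0] linear_0[OF lin[OF x]] by simp
  also have "\<dots> = D (energy F') (\<Phi> (x, y)) (D \<phi> x v, 0) + D (energy F') (\<Phi> (x, y)) (0, ?D2 v)"
    using linear_add[OF smooth_on_linear_D[OF sE' \<Phi>_in[OF p]], of "(D \<phi> x v, 0)" "(0, ?D2 v)"] by simp
  finally show ?thesis using A by (simp add: euler_lagrange_def \<Phi>_def)
qed

section \<open>Transition maps and the geodesic equation\<close>

lemma chart_facts:
  assumes "smooth_atlas A" "c \<in> A"
  shows "open (fst c)" "open (chart_image c)"
    "continuous_on (chart_image c) (chart_inv c)"
    "\<And>p. p \<in> fst c \<Longrightarrow> chart_inv c (snd c p) = p"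
    "\<And>x. x \<in> chart_image c \<Longrightarrow> snd c (chart_inv c x) = x"
    "\<And>x. x \<in> chart_image c \<Longrightarrow> chart_inv c x \<in> fst c"
    "\<And>p. p \<in> fst c \<Longrightarrow> snd c p \<in> chart_image c"
proof -
  have "open (fst c)" "open (chart_image c)" and h: "homeomorphism (fst c) (chart_image c) (snd c) (chart_inv c)"
    using assms unfolding smooth_atlas_def by blast+
  then show "open (fst c)" "open (chart_image c)" by simp_all
  show "continuous_on (chart_image c) (chart_inv c)"
    using h by (auto simp: homeomorphism_def)
  show "\<And>p. p \<in> fst c \<Longrightarrow> chart_inv c (snd c p) = p" using h by (auto simp: homeomorphism_def)
  show "\<And>x. x \<in> chart_image c \<Longrightarrow> snd c (chart_inv c x) = x" using h by (auto simp: homeomorphism_def)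
  show "\<And>x. x \<in> chart_image c \<Longrightarrow> chart_inv c x \<in> fst c" using h by (auto simp: homeomorphism_def)
  show "\<And>p. p \<in> fst c \<Longrightarrow> snd c p \<in> chart_image c" by (simp add: chart_image_def)
qed

lemma open_chart_image_of_open:
  assumes A: "smooth_atlas A" "c \<in> A" and "open V"
  shows "open (snd c ` (fst c \<inter> V))"
proof -
  note f = chart_facts[OF A]
  have "snd c ` (fst c \<inter> V) = chart_image c \<inter> chart_inv c -` V"
    using f(4,5,6,7) by (force simp: image_iff)
  then show ?thesis using continuous_open_preimage[OF f(3,2) assms(3)] by simp
qed

lemma smooth_transition:
  assumes "smooth_atlas A" "c \<in> A" "d \<in> A"
  shows "smooth_on (snd c ` (fst c \<inter> fst d)) (transition c d)"
  using assms unfolding smooth_atlas_def by blast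

lemma transition_chart: 
  assumes "smooth_atlas A" "c \<in> A" "p \<in> fst c"
  shows "transition c d (snd c p) = snd d p"
  using chart_facts(4)[OF assms] by (simp add: transition_def)

lemma transition_differentiable:
  assumes "smooth_atlas A" "c \<in> A" "d \<in> A" "p \<in> fst c" "p \<in> fst d"
  shows "transition c d differentiable (at (snd c p))"
  using smooth_on_differentiable[OF smooth_transition[OF assms(1-3)]] assms by blast

lemma D_transition_compose:
  assumes A: "smooth_atlas A" "c \<in> A" "d \<in> A" "e \<in> A" and p: "p \<in> fst c" "p \<in> fst d" "p \<in> fst e"
  shows "D (transition c e) (snd c p) y = D (transition d e) (snd d p) (D (transition c d) (snd c p) y)"
proof -
  let ?V = "snd c ` (fst c \<inter> (fst d \<inter> fst e))"
  have V: "open ?V" "snd c p \<in> ?V"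
    using A p by (auto intro!: open_chart_image_of_open chart_facts(1))
  have "D (transition c e) (snd c p) = D (transition d e \<circ> transition c d) (snd c p)"
    by (rule D_cong[OF V]) (auto simp: transition_chart[OF A(1,2)] transition_chart[OF A(1,3)])
  also have "\<dots> = D (transition d e) (transition c d (snd c p)) \<circ> D (transition c d) (snd c p)"
    by (rule frechet_derivative_compose)
       (use A p in \<open>simp_all add: transition_chart[OF A(1,2)] transition_differentiable\<close>)
  finally show ?thesis using transition_chart[OF A(1,2) p(1)] by simp
qed

lemma D_transition_self:
  assumes A: "smooth_atlas A" "c \<in> A" and p: "p \<in> fst c"
  shows "D (transition c c) (snd c p) y = y"
proof -
  have "D (transition c c) (snd c p) = D (\<lambda>x. x) (snd c p)"
    by (rule D_cong[OF chart_facts(2)[OF A]])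
       (use p chart_facts[OF A] in \<open>auto simp: transition_def\<close>)
  then show ?thesis by simp
qed

lemma D_transition_inverse:
  assumes A: "smooth_atlas A" "c \<in> A" "d \<in> A" and p: "p \<in> fst c" "p \<in> fst d"
  shows "D (transition d c) (snd d p) (D (transition c d) (snd c p) y) = y"
  using D_transition_compose[OF A A(2) p p(1)] D_transition_self[OF A(1,2) p(1)] by simp

lemma D_transition_nonzero:
  assumes A: "smooth_atlas A" "c \<in> A" "d \<in> A" and p: "p \<in> fst c" "p \<in> fst d" and "y \<noteq> 0"
  shows "D (transition c d) (snd c p) y \<noteq> 0"
proof
  assume "D (transition c d) (snd c p) y = 0"
  moreover have "linear (D (transition d c) (snd d p))"
    by (rule linear_frechet_derivative[OF transition_differentiable[OF A(1,3,2) p(2,1)]])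
  ultimately show False using D_transition_inverse[OF A p, of y] \<open>y \<noteq> 0\<close> linear_0 by fastforce
qed

text \<open>Both sides evaluate \<open>L\<close> at the same tangent vector, by the chain rule for transition maps.\<close>

lemma local_rep_transition:
  assumes A: "smooth_atlas A" "c \<in> A" "d \<in> A" and p: "p \<in> fst c" "p \<in> fst d"
  shows "local_rep A c L (snd c p) y = local_rep A d L (snd d p) (D (transition c d) (snd c p) y)"
proof -
  have "tangent_vec A c p y = tangent_vec A d p (D (transition c d) (snd c p) y)"
    unfolding tangent_vec_def using D_transition_compose[OF A _ p] by (intro ext) auto
  then show ?thesis
    by (simp add: local_rep_def chart_facts(4)[OF A(1,2) p(1)] chart_facts(4)[OF A(1,3) p(2)])
qed

lemma finsler_imp_finsler_chart:
  assumes "smooth_atlas A" "finsler A L" "c \<in> A"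
  shows "finsler_chart (chart_image c) (local_rep A c L)"
  using assms chart_facts(2)[OF assms(1,3)] unfolding finsler_def finsler_chart_def by blast

lemma euler_lagrange_local_rep_transition:
  assumes A: "smooth_atlas A" "c \<in> A" "d \<in> A" and L: "finsler A L" and p: "p \<in> fst c" "p \<in> fst d" and y: "y \<noteq> 0"
  defines "\<phi> \<equiv> transition c d"
  shows "euler_lagrange (local_rep A c L) (snd c p) y a v = euler_lagrange (local_rep A d L) (snd d p) (D \<phi> (snd c p) y)
    (D \<phi> (snd c p) a + D (\<lambda>q. D \<phi> q y) (snd c p) y) (D \<phi> (snd c p) v)"
proof -
  let ?W = "snd c ` (fst c \<inter> fst d)"
  have "euler_lagrange (local_rep A c L) (snd c p) y a v = euler_lagrange (local_rep A d L) (\<phi> (snd c p)) (D \<phi> (snd c p) y)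
    (D \<phi> (snd c p) a + D (\<lambda>q. D \<phi> q y) (snd c p) y) (D \<phi> (snd c p) v)"
  proof (rule euler_lagrange_transform[OF finsler_imp_finsler_chart[OF A(1) L A(2)] finsler_imp_finsler_chart[OF A(1) L A(3)], of ?W])
    show "open ?W" by (rule open_chart_image_of_open[OF A(1,2) chart_facts(1)[OF A(1,3)]])
    show "?W \<subseteq> chart_image c" by (auto simp: chart_image_def)
    show "smooth_on ?W \<phi>" unfolding \<phi>_def by (rule smooth_transition[OF A])
    show "\<phi> ` ?W \<subseteq> chart_image d" by (auto simp: \<phi>_def transition_chart[OF A(1,2)] chart_image_def)
    show "snd c p \<in> ?W" using p by auto
    show "D \<phi> x y \<noteq> 0" if "x \<in> ?W" "y \<noteq> 0" for x y
      using that D_transition_nonzero[OF A] by (auto simp: \<phi>_def)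
    show "local_rep A c L x y = local_rep A d L (\<phi> x) (D \<phi> x y)" if "x \<in> ?W" "y \<noteq> 0" for x y
      using that local_rep_transition[OF A] by (auto simp: \<phi>_def transition_chart[OF A(1,2)])
  qed (rule y)
  then show ?thesis by (simp add: \<phi>_def transition_chart[OF A(1,2) p(1)])
qed

text \<open>The equation \<open>x'' + 2 G = 0\<close> says that the Euler-Lagrange covector vanishes, which does not depend on
  the chart: every test vector in the second chart is the image of one in the first.\<close>

lemma spray_transition:
  assumes A: "smooth_atlas A" "c \<in> A" "d \<in> A" and L: "finsler A L" and p: "p \<in> fst c" "p \<in> fst d" and y: "y \<noteq> 0"
    and a: "a + 2 *\<^sub>R spray (local_rep A c L) (snd c p) y = 0"
  defines "\<phi> \<equiv> transition c d"
  shows "D \<phi> (snd c p) a + D (\<lambda>q. D \<phi> q y) (snd c p) y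
    + 2 *\<^sub>R spray (local_rep A d L) (snd d p) (D \<phi> (snd c p) y) = 0"
proof -
  interpret c: finsler_chart "chart_image c" "local_rep A c L" by (rule finsler_imp_finsler_chart[OF A(1) L A(2)])
  interpret d: finsler_chart "chart_image d" "local_rep A d L" by (rule finsler_imp_finsler_chart[OF A(1) L A(3)])
  have pc: "(snd c p, y) \<in> c.\<Omega>" using p y by (simp add: chart_image_def)
  have pd: "(snd d p, D \<phi> (snd c p) y) \<in> d.\<Omega>"
    using p D_transition_nonzero[OF A p y] by (simp add: chart_image_def \<phi>_def)
  show ?thesis
    unfolding d.spray_eq_iff_euler_lagrange[OF pd]
  proof
    fix v
    define w where "w = D (transition d c) (snd d p) v"
    have v: "v = D \<phi> (snd c p) w"
      using D_transition_inverse[OF A(1,3,2) p(2,1)] by (simp add: w_def \<phi>_def)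
    have "euler_lagrange (local_rep A c L) (snd c p) y a w = 0" using a c.spray_eq_iff_euler_lagrange[OF pc] by blast
    then show "euler_lagrange (local_rep A d L) (snd d p) (D \<phi> (snd c p) y)
        (D \<phi> (snd c p) a + D (\<lambda>q. D \<phi> q y) (snd c p) y) v = 0"
      using euler_lagrange_local_rep_transition[OF A L p y, of a w] v by (simp add: \<phi>_def)
  qed
qed

section \<open>Geodesics and projectively related sprays\<close>

text \<open>The local solution of \<open>x'' = - 2 G (x, x')\<close> in the chart \<open>c\<close>. It satisfies the geodesic equation with
  the multiplier \<open>w = 0\<close>, which makes the condition in the other charts the vanishing of the
  Euler-Lagrange covector.\<close>

lemma geodesic_exists:
  fixes A :: "('m::{t2_space, second_countable_topology}, 'n::finite) chart set"
  assumes A: "smooth_atlas A" and L: "finsler A L" and c: "c \<in> A" and x: "x \<in> chart_image c" and y: "y \<noteq> 0"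
  obtains \<delta> \<gamma> u where "\<delta> > 0" "geodesic A L {-\<delta><..<\<delta>} \<gamma>" "\<And>t. t \<in> {-\<delta><..<\<delta>} \<Longrightarrow> \<gamma> t \<in> fst c"
    "\<And>t. t \<in> {-\<delta><..<\<delta>} \<Longrightarrow> ((\<lambda>s. snd c (\<gamma> s)) has_vector_derivative u t) (at t)"
    "snd c (\<gamma> 0) = x" "u 0 = y"
    "(u has_vector_derivative - 2 *\<^sub>R spray (local_rep A c L) x y) (at 0)"
proof -
  let ?F = "local_rep A c L"
  interpret finsler_chart "chart_image c" ?F by (rule finsler_imp_finsler_chart[OF A L c])
  \<comment> \<open>the geodesic equation as a first-order system for position and velocity\<close>
  define X where "X q = (snd q, - 2 *\<^sub>R spray ?F (fst q) (snd q))" for q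
  have "smooth_on \<Omega> (\<lambda>q. (snd q, 0) + (\<Sum>i\<in>UNIV. spray ?F (fst q) (snd q) $ i *\<^sub>R (0, - 2 *\<^sub>R axis i 1)))"
    by (intro smooth_on_add smooth_on_sum smooth_on_scaleR open_\<Omega> smooth_spray smooth_on_const
        smooth_on_bounded_linear bounded_linear_Pair bounded_linear_snd bounded_linear_zero)
  then have "smooth_on \<Omega> X"
  proof (rule smooth_on_cong[OF open_\<Omega>])
    fix q :: "(real ^ 'n) \<times> (real ^ 'n)"
    have "(\<Sum>i\<in>UNIV. spray ?F (fst q) (snd q) $ i *\<^sub>R (- 2 *\<^sub>R axis i 1)) = - 2 *\<^sub>R spray ?F (fst q) (snd q)"
      by (subst (2) basis_expansion[of "spray ?F (fst q) (snd q)", symmetric])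
         (simp add: scaleR_sum_right scalar_mult_eq_scaleR sum_negf mult.commute)
    then show "(snd q, 0) + (\<Sum>i\<in>UNIV. spray ?F (fst q) (snd q) $ i *\<^sub>R (0, - 2 *\<^sub>R axis i 1)) = X q"
      by (simp add: X_def sum_prod prod_eq_iff fst_sum snd_sum)
  qed
  then have "Ck_on 1 \<Omega> X" by (simp add: smooth_on_def)
  moreover have "(x, y) \<in> \<Omega>" using x y by simp
  ultimately obtain \<delta> z where \<delta>: "\<delta> > 0" "z 0 = (x, y)" "\<And>t. t \<in> {-\<delta><..<\<delta>} \<Longrightarrow> z t \<in> \<Omega>"
    "\<And>t. t \<in> {-\<delta><..<\<delta>} \<Longrightarrow> (z has_vector_derivative X (z t)) (at t)"
    using C1_ode_local_solution[OF open_\<Omega>] by metis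
  let ?J = "{-\<delta><..<\<delta>}"
  define r where "r t = fst (z t)" for t
  define u where "u t = snd (z t)" for t
  have r: "(r has_vector_derivative u t) (at t)" if "t \<in> ?J" for t
    using bounded_linear.has_vector_derivative[OF bounded_linear_fst \<delta>(4)[OF that]]
    by (simp add: r_def [abs_def] u_def X_def)
  have u: "(u has_vector_derivative - 2 *\<^sub>R spray ?F (r t) (u t)) (at t)" if "t \<in> ?J" for t
    using bounded_linear.has_vector_derivative[OF bounded_linear_snd \<delta>(4)[OF that]]
    by (simp add: r_def u_def[abs_def] X_def)
  have in_chart: "r t \<in> chart_image c" and u0: "u t \<noteq> 0" if "t \<in> ?J" for t
    using \<delta>(3)[OF that] by (auto simp: r_def u_def)
  define \<gamma> where "\<gamma> t = chart_inv c (r t)" for t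
  have \<gamma>: "\<gamma> t \<in> fst c" "snd c (\<gamma> t) = r t" if "t \<in> ?J" for t
    using chart_facts[OF A c] in_chart[OF that] by (auto simp: \<gamma>_def)
  have ev_J: "\<forall>\<^sub>F s in nhds t. s \<in> ?J" if "t \<in> ?J" for t
    using that by (intro eventually_nhds_in_open) auto
  have cont: "continuous_on ?J \<gamma>"
  proof -
    have "continuous_on ?J r"
      using r has_vector_derivative_continuous by (intro continuous_at_imp_continuous_on) blast
    then show ?thesis
      unfolding \<gamma>_def by (intro continuous_on_compose2[OF chart_facts(3)[OF A c]]) (use in_chart in auto)
  qed
  have "geodesic A L ?J \<gamma>"
    unfolding geodesic_def
  proof (intro conjI exI[of _ "\<lambda>_. 0 :: real"] ballI)
    show "is_interval ?J" by (simp add: is_interval_oo)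
    fix d assume d: "d \<in> A"
    let ?\<phi> = "transition c d"
    let ?W = "snd c ` (fst c \<inter> fst d)"
    have W: "open ?W" by (rule open_chart_image_of_open[OF A c chart_facts(1)[OF A d]])
    define ud where "ud t = D ?\<phi> (r t) (u t)" for t
    show "\<exists>y. \<forall>t\<in>?J. \<gamma> t \<in> fst d \<longrightarrow>
       ((\<lambda>s. snd d (\<gamma> s)) has_vector_derivative y t) (at t) \<and> y t \<noteq> 0 \<and>
        (\<exists>z. (y has_vector_derivative z) (at t) \<and>
             z + 2 *\<^sub>R spray (local_rep A d L) (snd d (\<gamma> t)) (y t) = 0 *\<^sub>R y t)"
    proof (intro exI[of _ ud] ballI impI conjI)
      fix t assume t: "t \<in> ?J" and td: "\<gamma> t \<in> fst d"
      have rW: "r t \<in> ?W" using \<gamma>[OF t] td by force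
      note sm = smooth_transition[OF A c d]
      have "((\<lambda>s. ?\<phi> (r s)) has_vector_derivative ud t) (at t)"
        unfolding ud_def by (rule has_vector_derivative_compose_D[OF smooth_on_differentiable[OF sm rW] r[OF t]])
      moreover have "\<forall>\<^sub>F s in nhds t. ?\<phi> (r s) = snd d (\<gamma> s)"
        using ev_J[OF t] by eventually_elim (simp add: transition_def \<gamma>_def)
      ultimately show "((\<lambda>s. snd d (\<gamma> s)) has_vector_derivative ud t) (at t)"
        by (rule has_vector_derivative_eventually_cong)
      show "ud t \<noteq> 0"
        using D_transition_nonzero[OF A c d \<gamma>(1)[OF t] td u0[OF t]] \<gamma>(2)[OF t] by (simp add: ud_def)
      let ?z = "D ?\<phi> (r t) (- 2 *\<^sub>R spray ?F (r t) (u t)) + D (\<lambda>q. D ?\<phi> q (u t)) (r t) (u t)"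
      have "(ud has_vector_derivative ?z) (at t)"
        unfolding ud_def by (rule has_vector_derivative_D_along[OF W rW sm r[OF t] u[OF t]])
      moreover have "?z + 2 *\<^sub>R spray (local_rep A d L) (snd d (\<gamma> t)) (ud t) = 0 *\<^sub>R ud t"
        using spray_transition[OF A c d L \<gamma>(1)[OF t] td u0[OF t], of "- 2 *\<^sub>R spray ?F (r t) (u t)"] \<gamma>(2)[OF t]
        by (simp add: ud_def)
      ultimately show "\<exists>z. (ud has_vector_derivative z) (at t) \<and>
             z + 2 *\<^sub>R spray (local_rep A d L) (snd d (\<gamma> t)) (ud t) = 0 *\<^sub>R ud t" by blast
    qed
  qed (use cont in auto)
  moreover have "((\<lambda>s. snd c (\<gamma> s)) has_vector_derivative u t) (at t)" if t: "t \<in> ?J" for t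
  proof (rule has_vector_derivative_eventually_cong[OF r[OF t]])
    show "\<forall>\<^sub>F s in nhds t. r s = snd c (\<gamma> s)" using ev_J[OF t] by eventually_elim (simp add: \<gamma>(2))
  qed
  moreover have "r 0 = x" "u 0 = y" using \<delta>(2) by (simp_all add: r_def u_def)
  ultimately show ?thesis
    using \<delta>(1) \<gamma> u[of 0] by (intro that[of \<delta> \<gamma> u]) auto
qed

text \<open>A curve determines its velocity and acceleration, so the geodesic equations of the two metrics at
  time 0 can be subtracted.\<close>

lemma projective_imp_spray_parallel:
  assumes A: "smooth_atlas A" and L: "finsler A L" and pr: "projective A L L'"
    and c: "c \<in> A" and x: "x \<in> chart_image c" and y: "y \<noteq> 0"
  obtains r where "spray (local_rep A c L') x y = spray (local_rep A c L) x y + r *\<^sub>R y"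
proof -
  let ?G = "spray (local_rep A c L) x y"
  let ?G' = "spray (local_rep A c L') x y"
  obtain \<delta> \<gamma> u where g: "\<delta> > 0" "geodesic A L {-\<delta><..<\<delta>} \<gamma>" "\<And>t. t \<in> {-\<delta><..<\<delta>} \<Longrightarrow> \<gamma> t \<in> fst c"
    and \<gamma>: "\<And>t. t \<in> {-\<delta><..<\<delta>} \<Longrightarrow> ((\<lambda>s. snd c (\<gamma> s)) has_vector_derivative u t) (at t)"
    and 0: "snd c (\<gamma> 0) = x" "u 0 = y" and u: "(u has_vector_derivative - 2 *\<^sub>R ?G) (at 0)"
    by (rule geodesic_exists[OF A L c x y]) blast
  let ?J = "{-\<delta><..<\<delta>}"
  have "geodesic A L' ?J \<gamma>" using pr g(2) unfolding projective_def by blast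
  then obtain w yy where w: "\<forall>t\<in>?J. \<gamma> t \<in> fst c \<longrightarrow>
        ((\<lambda>s. snd c (\<gamma> s)) has_vector_derivative yy t) (at t) \<and> yy t \<noteq> 0 \<and>
        (\<exists>z. (yy has_vector_derivative z) (at t) \<and>
             z + 2 *\<^sub>R spray (local_rep A c L') (snd c (\<gamma> t)) (yy t) = w t *\<^sub>R yy t)"
    unfolding geodesic_def using c by meson
  have yy: "yy t = u t" if "t \<in> ?J" for t
    using w g(3)[OF that] \<gamma>[OF that] that vector_derivative_unique_at by blast
  have J0: "0 \<in> ?J" using g(1) by simp
  then obtain z where z: "(yy has_vector_derivative z) (at 0)" "z + 2 *\<^sub>R ?G' = w 0 *\<^sub>R y"
    using w g(3)[OF J0] 0 yy[OF J0] by force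
  have "\<forall>\<^sub>F s in nhds 0. u s = yy s"
    using eventually_nhds_in_open[OF _ J0] by (rule eventually_mono) (use yy in auto)
  from has_vector_derivative_eventually_cong[OF u this] z(1) have "z = - 2 *\<^sub>R ?G"
    using vector_derivative_unique_at by blast
  with z(2) have "2 *\<^sub>R ?G' = 2 *\<^sub>R (?G + (w 0 / 2) *\<^sub>R y)"
    by (simp add: algebra_simps)
  then have "?G' = ?G + (w 0 / 2) *\<^sub>R y" by (simp only: scaleR_cancel_left) simp
  then show ?thesis by (rule that)
qed

section \<open>Riemannian sprays are quadratic\<close>

context finsler_chart begin

text \<open>A relation between functions of the base point at fixed fibre vectors \<open>y\<close>, \<open>y0\<close> may be differentiated
  in the base directions.\<close>

lemma D_fst_of_combination:
  fixes g :: "(real ^ 'n) \<times> (real ^ 'n) \<Rightarrow> real" and gi :: "'i \<Rightarrow> (real ^ 'n) \<times> (real ^ 'n) \<Rightarrow> real"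
  assumes g: "smooth_on \<Omega> g" and gi: "\<And>i. i \<in> I \<Longrightarrow> smooth_on \<Omega> (gi i)"
    and x: "x \<in> U" and y: "y \<noteq> 0" "y0 \<noteq> 0"
    and eq: "\<And>q. q \<in> U \<Longrightarrow> g (q, y) = (\<Sum>i\<in>I. c i * gi i (q, y0))"
  shows "D g (x, y) (v, 0) = (\<Sum>i\<in>I. c i * D (gi i) (x, y0) (v, 0))"
proof -
  have line: "((\<lambda>s. h (x + s *\<^sub>R v, y)) has_real_derivative D h (x, y) (v, 0)) (at 0)"
    if "smooth_on \<Omega> h" "y \<noteq> 0" for h :: "(real ^ 'n) \<times> (real ^ 'n) \<Rightarrow> real" and y
  proof -
    have "((\<lambda>s. (x + s *\<^sub>R v, y)) has_vector_derivative (v, 0)) (at 0)"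
      by (intro has_vector_derivative_Pair has_vector_derivative_const line_has_vector_derivative)
    from has_vector_derivative_compose_D[of h, OF _ this] show ?thesis
      using smooth_on_differentiable[OF that(1), of "(x, y)"] x that(2)
      by (simp add: has_real_derivative_iff_has_vector_derivative)
  qed
  have "((\<lambda>s. \<Sum>i\<in>I. c i * gi i (x + s *\<^sub>R v, y0)) has_real_derivative (\<Sum>i\<in>I. c i * D (gi i) (x, y0) (v, 0))) (at 0)"
    by (intro DERIV_sum DERIV_cmult line gi y)
  then have "((\<lambda>s. \<Sum>i\<in>I. c i * gi i (x + s *\<^sub>R v, y0)) has_vector_derivative (\<Sum>i\<in>I. c i * D (gi i) (x, y0) (v, 0))) (at 0)"
    by (simp add: has_real_derivative_iff_has_vector_derivative)
  then have "((\<lambda>s. g (x + s *\<^sub>R v, y)) has_vector_derivative (\<Sum>i\<in>I. c i * D (gi i) (x, y0) (v, 0))) (at 0)"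
  proof (rule has_vector_derivative_eventually_cong)
    show "\<forall>\<^sub>F s in nhds 0. (\<Sum>i\<in>I. c i * gi i (x + s *\<^sub>R v, y0)) = g (x + s *\<^sub>R v, y)"
      using eventually_line_in_open[OF open_U x, of v] by eventually_elim (simp add: eq)
  qed
  then show ?thesis
    using line[OF g y(1)] vector_derivative_unique_at
    by (simp add: has_real_derivative_iff_has_vector_derivative) blast
qed

text \<open>For a fundamental tensor independent of \<open>y\<close>, Euler's relation in degrees one and two shows that
  \<open>\<partial>E/\<partial>y\<^sup>j\<close> is linear and \<open>E\<close> quadratic in \<open>y\<close>, with coefficients that are functions of the base point.
  So the base derivatives that define the spray are polynomials in \<open>y\<close> as well. The
  coefficients are read off at a fixed nonzero vector \<open>y0\<close>, because the functions are not controlled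
  on the zero section.\<close>

lemma spray_quadratic:
  assumes riem: "\<And>x y y'. x \<in> U \<Longrightarrow> y \<noteq> 0 \<Longrightarrow> y' \<noteq> 0 \<Longrightarrow> fund_tensor F x y = fund_tensor F x y'"
    and x: "x \<in> U"
  obtains c where "\<And>y h. y \<noteq> 0 \<Longrightarrow> spray F x y $ h = (\<Sum>a\<in>UNIV. \<Sum>b\<in>UNIV. c h a b * y $ a * y $ b)"
proof -
  define y0 :: "real ^ 'n" where "y0 = axis undefined 1"
  have y0: "y0 \<noteq> 0" by (simp add: y0_def axis_eq_0_iff)
  define E2 where "E2 j k = (\<lambda>p. D (E' j) p (0, axis k 1))" for j k
  have sE2: "smooth_on \<Omega> (E2 j k)" for j k unfolding E2_def by (rule smooth_on_D[OF smooth_E'])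
  have E2: "E2 j k (q, y) = E2 j k (q, y0)" if "q \<in> U" "y \<noteq> 0" for j k q y
    using riem[OF that y0] fund_tensor_nth[of q y k j] fund_tensor_nth[of q y0 k j] that y0 by (simp add: E2_def)
  have E1: "E' j (q, y) = (\<Sum>k\<in>UNIV. y $ k * E2 j k (q, y0))" if "q \<in> U" "y \<noteq> 0" for j q y
  proof -
    have p: "(q, y) \<in> \<Omega>" using that by simp
    have "D (E' j) (q, y) (0, y) = of_nat 1 * E' j (q, y)"
      by (rule euler_homogeneous) (use smooth_on_differentiable[OF smooth_E' p] E'_hom[OF p] in auto)
    then show ?thesis using sum_D_axis_snd[OF smooth_E' p, of j y] E2[OF that] by (simp add: E2_def)
  qed
  have E0: "E (q, y) = (\<Sum>(j, k)\<in>UNIV. (1 / 2 * y $ j * y $ k) * E2 j k (q, y0))" if "q \<in> U" "y \<noteq> 0" for q y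
  proof -
    have p: "(q, y) \<in> \<Omega>" using that by simp
    have "D E (q, y) (0, y) = of_nat 2 * E (q, y)"
      by (rule euler_homogeneous) (use smooth_on_differentiable[OF smooth_E p] E_hom[OF p] in auto)
    moreover have "D E (q, y) (0, y) = (\<Sum>j\<in>UNIV. \<Sum>k\<in>UNIV. y $ j * (y $ k * E2 j k (q, y0)))"
      by (simp add: sum_D_axis_snd[OF smooth_E p, of y] E1[OF that] sum_distrib_left)
    ultimately have "E (q, y) = 1 / 2 * (\<Sum>j\<in>UNIV. \<Sum>k\<in>UNIV. y $ j * (y $ k * E2 j k (q, y0)))" by simp
    also have "\<dots> = (\<Sum>(j, k)\<in>UNIV. (1 / 2 * y $ j * y $ k) * E2 j k (q, y0))"
      unfolding UNIV_Times_UNIV[symmetric] sum.cartesian_product[symmetric]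
      by (simp add: sum_distrib_left mult_ac)
    finally show ?thesis .
  qed
  define B where "B j k a = D (E2 j k) (x, y0) (axis a 1, 0)" for j k a
  define \<beta> where "\<beta> j a b = B j b a - 1 / 2 * B a b j" for j a b
  have coords: "lowered_spray (x, y) $ j = (\<Sum>a\<in>UNIV. \<Sum>b\<in>UNIV. \<beta> j a b * y $ a * y $ b)" if y: "y \<noteq> 0" for y j
  proof -
    have p: "(x, y) \<in> \<Omega>" using x y by simp
    have "D (E' j) (x, y) (axis a 1, 0) = (\<Sum>b\<in>UNIV. y $ b * B j b a)" for a
      unfolding B_def by (rule D_fst_of_combination[OF smooth_E' sE2 x y y0 E1[OF _ y]])
    then have 1: "D (E' j) (x, y) (y, 0) = (\<Sum>a\<in>UNIV. \<Sum>b\<in>UNIV. y $ a * (y $ b * B j b a))"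
      by (simp add: sum_D_axis_fst[OF smooth_E' p, of j y] sum_distrib_left)
    have "D E (x, y) (axis j 1, 0) = (\<Sum>i\<in>UNIV. (1 / 2 * y $ fst i * y $ snd i) * D (E2 (fst i) (snd i)) (x, y0) (axis j 1, 0))"
      by (rule D_fst_of_combination[OF smooth_E sE2 x y y0]) (simp add: E0[OF _ y] case_prod_beta)
    also have "\<dots> = (\<Sum>(a, b)\<in>UNIV. (1 / 2 * y $ a * y $ b) * B a b j)"
      by (simp add: B_def case_prod_beta)
    also have "\<dots> = (\<Sum>a\<in>UNIV. \<Sum>b\<in>UNIV. (1 / 2 * y $ a * y $ b) * B a b j)"
      unfolding UNIV_Times_UNIV[symmetric] sum.cartesian_product[symmetric] ..
    finally show ?thesis
      unfolding lowered_spray_def using 1 by (simp add: \<beta>_def left_diff_distrib right_diff_distrib sum_subtractf mult_ac)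
  qed
  let ?M = "matrix_inv (fund_tensor F x y0)"
  show ?thesis
  proof (rule that)
    fix y :: "real ^ 'n" and h assume y: "y \<noteq> 0"
    have p: "(x, y) \<in> \<Omega>" using x y by simp
    have "spray F x y $ h = 1 / 4 * (\<Sum>j\<in>UNIV. ?M $ h $ j * (\<Sum>a\<in>UNIV. \<Sum>b\<in>UNIV. \<beta> j a b * y $ a * y $ b))"
      by (simp add: spray_eq[OF p] riem[OF x y y0] matrix_vector_mult_def coords[OF y])
    also have "\<dots> = (\<Sum>j\<in>UNIV. \<Sum>a\<in>UNIV. \<Sum>b\<in>UNIV. 1 / 4 * (?M $ h $ j * (\<beta> j a b * y $ a * y $ b)))"
      by (simp only: sum_distrib_left)
    also have "\<dots> = (\<Sum>a\<in>UNIV. \<Sum>j\<in>UNIV. \<Sum>b\<in>UNIV. 1 / 4 * (?M $ h $ j * (\<beta> j a b * y $ a * y $ b)))"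
      by (rule sum.swap)
    also have "\<dots> = (\<Sum>a\<in>UNIV. \<Sum>b\<in>UNIV. \<Sum>j\<in>UNIV. 1 / 4 * (?M $ h $ j * (\<beta> j a b * y $ a * y $ b)))"
      by (rule sum.cong[OF refl], rule sum.swap)
    also have "\<dots> = (\<Sum>a\<in>UNIV. \<Sum>b\<in>UNIV. (\<Sum>j\<in>UNIV. 1 / 4 * (?M $ h $ j * \<beta> j a b)) * y $ a * y $ b)"
      unfolding sum_distrib_right by (simp add: mult_ac)
    finally show "spray F x y $ h = \<dots>" .
  qed
qed

lemma spray_differentiable:
  assumes "x \<in> U" "y \<noteq> 0"
  shows "(\<lambda>y. spray F x y $ m) differentiable (at y)"
proof -
  have "(x, y) \<in> \<Omega>" using assms by simp
  from smooth_on_has_derivative[OF smooth_spray this]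
  have "((\<lambda>p. spray F (fst p) (snd p) $ m) has_derivative D (\<lambda>p. spray F (fst p) (snd p) $ m) (x, y)) (at (x, y))" .
  moreover have "((\<lambda>y. (x, y)) has_derivative (\<lambda>v. (0, v))) (at y)" by (auto intro!: derivative_eq_intros)
  ultimately show ?thesis using diff_chain_at unfolding differentiable_def by (fastforce simp: o_def)
qed

end

section \<open>Douglas tensor\<close>

lemma has_derivative_vec_nth: "((\<lambda>y. y $ i) has_derivative (\<lambda>v. v $ i)) F"
  by (rule bounded_linear_imp_has_derivative[OF bounded_linear_vec_nth])

lemma partial_linear_form: "partial i (\<lambda>y. \<Sum>a\<in>UNIV. l a * y $ a) y = l i"
proof -
  have d: "((\<lambda>y. \<Sum>a\<in>UNIV. l a * y $ a) has_derivative (\<lambda>v. \<Sum>a\<in>UNIV. l a * v $ a)) (at y)"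
    by (intro has_derivative_sum has_derivative_mult_right has_derivative_vec_nth)
  have "partial i (\<lambda>y. \<Sum>a\<in>UNIV. l a * y $ a) y = (\<Sum>a\<in>UNIV. l a * axis i 1 $ a)"
    using partial_eq_D[of "\<lambda>y. \<Sum>a\<in>UNIV. l a * y $ a" y i] d D_eqI[OF d] by (auto simp: differentiable_def)
  then show ?thesis by (simp add: axis_def if_distrib cong: if_cong)
qed

lemma quadratic_form_has_derivative:
  fixes y :: "real ^ 'n::finite"
  shows "((\<lambda>y. \<Sum>a\<in>UNIV. \<Sum>b\<in>UNIV. c a b * y $ a * y $ b) has_derivative
    (\<lambda>v. \<Sum>a\<in>UNIV. \<Sum>b\<in>UNIV. c a b * (y $ a * v $ b + v $ a * y $ b))) (at y)"
proof -
  have "((\<lambda>y. c a b * (y $ a * y $ b)) has_derivative (\<lambda>v. c a b * (y $ a * v $ b + v $ a * y $ b))) (at y)" for a b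
    by (intro has_derivative_mult_right has_derivative_mult has_derivative_vec_nth)
  then show ?thesis
    unfolding mult.assoc by (intro has_derivative_sum)
qed

lemma D_quadratic_form_axis:
  fixes y :: "real ^ 'n::finite"
  shows "(\<Sum>a\<in>UNIV. \<Sum>b\<in>UNIV. c a b * (y $ a * axis i 1 $ b + axis i 1 $ a * y $ b))
     = (\<Sum>a\<in>UNIV. (c i a + c a i) * y $ a)"
proof -
  have ax: "axis i 1 $ a = (if a = i then 1 else 0 :: real)" for a :: 'n by (simp add: axis_def)
  have "(\<Sum>b\<in>UNIV. c a b * (y $ a * axis i 1 $ b)) = (\<Sum>b\<in>UNIV. if b = i then c a i * y $ a else 0)" for a
    by (intro sum.cong) (auto simp: ax)
  moreover have "(\<Sum>a\<in>UNIV. \<Sum>b\<in>UNIV. c a b * (axis i 1 $ a * y $ b)) = (\<Sum>a\<in>UNIV. if a = i then \<Sum>b\<in>UNIV. c i b * y $ b else 0)"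
    by (intro sum.cong) (auto simp: ax)
  ultimately show ?thesis by (simp add: distrib_left distrib_right sum.distrib)
qed

lemma partial_quadratic_form:
  "partial i (\<lambda>y. \<Sum>a\<in>UNIV. \<Sum>b\<in>UNIV. c a b * y $ a * y $ b) y = (\<Sum>a\<in>UNIV. (c i a + c a i) * y $ a)"
  unfolding D_quadratic_form_axis[symmetric] D_eqI[OF quadratic_form_has_derivative, symmetric]
  by (rule partial_eq_D) (use quadratic_form_has_derivative differentiable_def in blast)

text \<open>The function is a quadratic form only off the origin, so each derivative is compared with that of
  the form on the open complement of the origin.\<close>

lemma third_partials_quadratic_form:
  fixes q :: "real ^ 'n::finite \<Rightarrow> real"
  assumes q: "\<And>y. y \<noteq> 0 \<Longrightarrow> q y = (\<Sum>a\<in>UNIV. \<Sum>b\<in>UNIV. c a b * y $ a * y $ b)" and y: "y \<noteq> 0"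
  shows "partial i (partial j (partial k q)) y = 0"
proof -
  have o: "open (- {0 :: real ^ 'n})" by (intro open_Compl) simp
  have 1: "partial k q y = (\<Sum>a\<in>UNIV. (c k a + c a k) * y $ a)" if "y \<noteq> 0" for y
    using partial_cong[OF o, of y q] q that by (simp add: partial_quadratic_form)
  have 2: "partial j (partial k q) y = c k j + c j k" if "y \<noteq> 0" for y
    using partial_cong[OF o, of y "partial k q"] 1 that by (simp add: partial_linear_form)
  have "partial i (partial j (partial k q)) y = partial i (\<lambda>_. c k j + c j k) y"
    by (rule partial_cong[OF o]) (use 2 y in auto)
  then show ?thesis by (simp add: partial_def)
qed

text \<open>Adding \<open>P y\<^sup>h\<close> to the spray adds \<open>(n + 1) P\<close> to its fibre divergence, by Euler's relation, and the two
  terms cancel in the expression under the third derivatives.\<close>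

lemma douglas_eq_0:
  fixes F :: "real ^ 'n::finite \<Rightarrow> real ^ 'n \<Rightarrow> real"
  assumes spray: "\<And>y m. y \<noteq> 0 \<Longrightarrow> spray F x y $ m = (\<Sum>a\<in>UNIV. \<Sum>b\<in>UNIV. c m a b * y $ a * y $ b) + P y * y $ m"
    and P: "\<And>y. y \<noteq> 0 \<Longrightarrow> P differentiable (at y)" "\<And>y r. y \<noteq> 0 \<Longrightarrow> r > 0 \<Longrightarrow> P (r *\<^sub>R y) = r * P y"
    and y: "y \<noteq> 0"
  shows "douglas F h i j k x y = 0"
proof -
  have o: "open (- {0 :: real ^ 'n})" by (intro open_Compl) simp
  have part: "partial m (\<lambda>y. spray F x y $ m) y
      = (\<Sum>a\<in>UNIV. (c m m a + c m a m) * y $ a) + (y $ m * D P y (axis m 1) + P y)" if y: "y \<noteq> 0" for m y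
  proof -
    let ?q = "\<lambda>y. \<Sum>a\<in>UNIV. \<Sum>b\<in>UNIV. c m a b * y $ a * y $ b"
    have d: "((\<lambda>y. ?q y + P y * y $ m) has_derivative
      (\<lambda>v. (\<Sum>a\<in>UNIV. \<Sum>b\<in>UNIV. c m a b * (y $ a * v $ b + v $ a * y $ b)) + (P y * v $ m + D P y v * y $ m))) (at y)"
      by (intro has_derivative_add quadratic_form_has_derivative has_derivative_mult has_derivative_vec_nth
          has_derivative_D P y)
    have "partial m (\<lambda>y. spray F x y $ m) y = partial m (\<lambda>y. ?q y + P y * y $ m) y"
      by (rule partial_cong[OF o]) (use spray y in auto)
    also have "\<dots> = D (\<lambda>y. ?q y + P y * y $ m) y (axis m 1)"
      by (rule partial_eq_D) (use d differentiable_def in blast)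
    also have "\<dots> = (\<Sum>a\<in>UNIV. (c m m a + c m a m) * y $ a) + (y $ m * D P y (axis m 1) + P y)"
      unfolding D_eqI[OF d] D_quadratic_form_axis by (simp add: mult.commute)
    finally show ?thesis .
  qed
  have euler: "(\<Sum>m\<in>UNIV. y $ m * D P y (axis m 1)) = P y" if y: "y \<noteq> 0" for y
  proof -
    \<comment> \<open>Euler's relation is available for functions on a product, so \<open>P\<close> gets a dummy first argument\<close>
    let ?h = "\<lambda>p :: real \<times> (real ^ 'n). P (snd p)"
    have "((\<lambda>p :: real \<times> (real ^ 'n). snd p) has_derivative snd) (at (0, y))" by (rule has_derivative_snd[OF has_derivative_ident])
    from diff_chain_at[OF this, of P "D P y"]
    have d: "(?h has_derivative (\<lambda>v. D P y (snd v))) (at (0, y))"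
      using has_derivative_D[OF P(1)[OF y]] by (simp add: o_def)
    have "D ?h (0, y) (0, y) = of_nat 1 * ?h (0, y)"
      by (rule euler_homogeneous) (use d differentiable_def P(2)[OF y] in auto)
    then have "D P y y = P y" using D_eqI[OF d] by simp
    moreover have "D P y y = (\<Sum>m\<in>UNIV. y $ m * D P y (axis m 1))"
      using arg_cong[OF basis_expansion[of y], of "D P y"]
      by (simp add: scalar_mult_eq_scaleR linear_sum[OF linear_frechet_derivative[OF P(1)[OF y]]]
        linear_cmul[OF linear_frechet_derivative[OF P(1)[OF y]]])
    ultimately show ?thesis by simp
  qed
  define l where "l a = (\<Sum>m\<in>UNIV. c m m a + c m a m)" for a
  let ?N = "real CARD('n) + 1"
  have div: "(\<Sum>m\<in>UNIV. partial m (\<lambda>y. spray F x y $ m) y) = (\<Sum>a\<in>UNIV. l a * y $ a) + ?N * P y" if y: "y \<noteq> 0" for y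
  proof -
    have "(\<Sum>m\<in>UNIV. \<Sum>a\<in>UNIV. (c m m a + c m a m) * y $ a) = (\<Sum>a\<in>UNIV. l a * y $ a)"
      unfolding l_def sum_distrib_right by (rule sum.swap)
    then show ?thesis by (simp add: part[OF y] sum.distrib euler[OF y] distrib_right)
  qed
  define q where "q y = spray F x y $ h - 1 / ?N * (y $ h * (\<Sum>m\<in>UNIV. partial m (\<lambda>y. spray F x y $ m) y))" for y
  have "q y = (\<Sum>a\<in>UNIV. \<Sum>b\<in>UNIV. (c h a b - (if a = h then l b / ?N else 0)) * y $ a * y $ b)" if y: "y \<noteq> 0" for y
  proof -
    have N: "?N \<noteq> 0" by (simp add: add_nonneg_eq_0_iff)
    have "(\<Sum>a\<in>UNIV. \<Sum>b\<in>UNIV. (if a = h then l b / ?N else 0) * y $ a * y $ b)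
        = (\<Sum>a\<in>UNIV. if a = h then y $ h * (\<Sum>b\<in>UNIV. l b * y $ b) / ?N else 0)"
      by (intro sum.cong refl) (simp add: sum_distrib_left sum_divide_distrib mult_ac)
    then have "(\<Sum>a\<in>UNIV. \<Sum>b\<in>UNIV. (if a = h then l b / ?N else 0) * y $ a * y $ b)
        = y $ h * (\<Sum>b\<in>UNIV. l b * y $ b) / ?N" by simp
    moreover have "q y = (\<Sum>a\<in>UNIV. \<Sum>b\<in>UNIV. c h a b * y $ a * y $ b) - y $ h * (\<Sum>b\<in>UNIV. l b * y $ b) / ?N"
      unfolding q_def div[OF y] spray[OF y] using N by (simp add: field_simps)
    ultimately show ?thesis by (simp add: left_diff_distrib sum_subtractf)
  qed
  from third_partials_quadratic_form[OF this y] have "partial i (partial j (partial k q)) y = 0" by simp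
  then show ?thesis
    by (simp add: douglas_def partial_y_def q_def[abs_def])
qed

theorem theorem5p6:
  fixes A :: "('m::{t2_space, second_countable_topology}, 'n::finite) chart set"
    and L Lbar \<beta> :: "('m, 'n) tfun"
    and \<sigma> :: "'m \<Rightarrow> real"
    and f :: "real \<times> real \<Rightarrow> real"
    and h i j k :: 'n
  assumes "smooth_atlas A"
    and "finsler A L"
    and "generalized_beta_conformal_change A L \<sigma> \<beta> f Lbar"
    and "finsler A Lbar"
    and "projective A L Lbar"
    and "riemannian A L"
    and "c \<in> A" and "x \<in> chart_image c" and "y \<noteq> 0"
    and "m_covector A c L \<beta> x y \<noteq> 0"
  shows "douglas (local_rep A c Lbar) h i j k x y = 0"
proof -
  note A = assms(1) and L = assms(2) and L' = assms(4) and pr = assms(5) and c = assms(7) and x = assms(8)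
  let ?G = "spray (local_rep A c L) x" and ?G' = "spray (local_rep A c Lbar) x"
  interpret L: finsler_chart "chart_image c" "local_rep A c L" by (rule finsler_imp_finsler_chart[OF A L c])
  interpret L': finsler_chart "chart_image c" "local_rep A c Lbar" by (rule finsler_imp_finsler_chart[OF A L' c])
  obtain C where C: "\<And>y m. y \<noteq> 0 \<Longrightarrow> ?G y $ m = (\<Sum>a\<in>UNIV. \<Sum>b\<in>UNIV. C m a b * y $ a * y $ b)"
    using L.spray_quadratic[of x] assms(6) c x unfolding riemannian_def by blast
  \<comment> \<open>an explicit formula for the factor between \<open>G' - G\<close> and \<open>y\<close>, from which differentiability and homogeneity are visible\<close>
  define P where "P y = (\<Sum>m\<in>UNIV. (?G' y $ m - ?G y $ m) * y $ m) / (y \<bullet> y)" for y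
  have P: "?G' y = ?G y + P y *\<^sub>R y" if y: "y \<noteq> 0" for y
  proof -
    obtain r where r: "?G' y = ?G y + r *\<^sub>R y"
      by (rule projective_imp_spray_parallel[OF A L pr c x y])
    then have "P y = r * (y \<bullet> y) / (y \<bullet> y)"
      by (simp add: P_def inner_vec_def sum_distrib_left mult_ac)
    then have "P y = r" using y by simp
    with r show ?thesis by simp
  qed
  show ?thesis
  proof (rule douglas_eq_0)
    show "?G' y $ m = (\<Sum>a\<in>UNIV. \<Sum>b\<in>UNIV. C m a b * y $ a * y $ b) + P y * y $ m" if "y \<noteq> 0" for y m
      using P[OF that] C[OF that] by simp
    show "P differentiable (at y)" if y: "y \<noteq> 0" for y
    proof -
      have "(\<lambda>y :: real ^ 'n. y $ m) differentiable (at y)" for m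
        using has_derivative_vec_nth differentiable_def by blast
      then have "(\<lambda>y. (?G' y $ m - ?G y $ m) * y $ m) differentiable (at y)" for m
        by (rule differentiable_mult[OF differentiable_diff[OF L'.spray_differentiable[OF x y] L.spray_differentiable[OF x y]]])
      then have "(\<lambda>y. \<Sum>m\<in>UNIV. (?G' y $ m - ?G y $ m) * y $ m) differentiable (at y)"
        by (intro differentiable_sum) auto
      then show ?thesis
        unfolding P_def by (rule differentiable_divide[OF _ differentiable_inner]) (use y in auto)
    qed
    show "P (r *\<^sub>R y) = r * P y" if "y \<noteq> 0" "r > 0" for y r
    proof -
      \<comment> \<open>two degrees come from the sprays, one from \<open>y\<close>; the denominator of \<open>P\<close> removes two\<close>
      have "(\<Sum>m\<in>UNIV. (?G' (r *\<^sub>R y) $ m - ?G (r *\<^sub>R y) $ m) * (r *\<^sub>R y) $ m) =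
          r ^ 3 * (\<Sum>m\<in>UNIV. (?G' y $ m - ?G y $ m) * y $ m)"
        using L.spray_hom[of x y r] L'.spray_hom[of x y r] x that
        by (simp add: sum_distrib_left algebra_simps power2_eq_square power3_eq_cube)
      then show ?thesis using that by (simp add: P_def power3_eq_cube)
    qed
  qed (rule assms(9))
qed

end
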